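(* Let $H^2$ be a finite closed two-manifold. If every one-disk $D^1\subseteq H^2$ is embedded in $H^2$, then $H^2$ is a two-sphere.
   Context: A digital space is a simple undirected graph with a finite or countable set of points (vertices). Subspaces are induced subgraphs; $H\subseteq G$ ("$H$ belongs to $G$") means $H$ is an induced subgraph of $G$. The rim $O(v)$ of a point $v$ is the subspace induced on the neighbors of $v$ (not containing $v$). $G-v$ is $G$ with the point $v$ deleted. Contractible graphs and contractible transformations: the one-point graph is contractible; the contractible transformations of a graph are (1) deleting a point $v$ with $O(v)$ contractible, (2) gluing a new point $v$ whose rim $O(v)$ is a contractible induced subgraph, (3) deleting an edge $(uv)$ with $O(u)\cap O(v)$ contractible, (4) adding an edge between non-adjacent points $u,v$ with $O(u)\cap O(v)$ contractible. A graph is contractible if it can be converted to a single point by a finite sequence of contractible transformations. Disks, spheres and manifolds are defined recursively. A 0-disk is a single point; a 0-sphere is the graph $S^0(a,b)$ with two non-adjacent points $a,b$. A 1-sphere is a finite connected graph in which the rim of each point is a 0-sphere. A 1-disk is a graph $S^1-v$ with $S^1$ a 1-sphere, $v\in S^1$. For $n\ge 1$: a closed $n$-manifold is a connected digital space in which the rim of every point is an $(n-1)$-sphere. An $n$-manifold with boundary is a connected space $N$ such that $N=M-v$ (up to isomorphism) for a closed $n$-manifold $M$ and a point $v\in M$; its boundary is $\partial N=O(v)$ and its interior is $\mathrm{Int}N=N-\partial N$ (so a 1-disk has as boundary its two end points). An $n$-disk is an $n$-manifold with boundary that is a contractible graph. For $n\ge 2$, an $n$-sphere is a graph $D\#C$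 obtained from two $n$-disks $D,C$ with isomorphic boundaries by identifying each point of $\partial D$ with its counterpart in $\partial C$ under an isomorphism. Embedded disk: a one-disk $D^1$ belonging to a two-manifold $H^2$ is embedded in $H^2$ if there is a two-disk $D^2$ belonging to $H^2$ such that $\partial D^1\subseteq\partial D^2$ and $\mathrm{Int}D^1\subseteq\mathrm{Int}D^2$. *)

theory Defs
  imports Main "HOL-Library.Countable_Set" "HOL-Library.Infinite_Typeclass"
begin

text \<open>A graph is a set of points together with its adjacency relation, in which every
  undirected edge occurs in both orientations.\<close>

record 'a graph =
  pts :: "'a set"
  edges :: "('a \<times> 'a) set"

definition digital_space :: "'a graph \<Rightarrow> bool" where
  "digital_space G \<longleftrightarrow>
     countable (pts G) \<and> edges G \<subseteq> pts G \<times> pts G \<and> sym (edges G) \<and> irrefl (edges G)"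

definition induced :: "'a graph \<Rightarrow> 'a set \<Rightarrow> 'a graph" where
  "induced G A = \<lparr>pts = A \<inter> pts G, edges = edges G \<inter> (A \<times> A)\<rparr>"

definition belongs_to :: "'a graph \<Rightarrow> 'a graph \<Rightarrow> bool" where
  "belongs_to H G \<longleftrightarrow> pts H \<subseteq> pts G \<and> H = induced G (pts H)"

definition nbrs :: "'a graph \<Rightarrow> 'a \<Rightarrow> 'a set" where
  "nbrs G v = {u. (v, u) \<in> edges G}"

definition rim :: "'a graph \<Rightarrow> 'a \<Rightarrow> 'a graph" where
  "rim G v = induced G (nbrs G v)"

definition delete_point :: "'a graph \<Rightarrow> 'a \<Rightarrow> 'a graph" where
  "delete_point G v = induced G (pts G - {v})"

definition connected_graph :: "'a graph \<Rightarrow> bool" where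
  "connected_graph G \<longleftrightarrow>
     pts G \<noteq> {} \<and> (\<forall>u\<in>pts G. \<forall>v\<in>pts G. (u, v) \<in> (edges G)\<^sup>*)"

definition graph_iso :: "('a \<Rightarrow> 'b) \<Rightarrow> 'a graph \<Rightarrow> 'b graph \<Rightarrow> bool" where
  "graph_iso f G H \<longleftrightarrow>
     bij_betw f (pts G) (pts H) \<and>
     (\<forall>x\<in>pts G. \<forall>y\<in>pts G. (x, y) \<in> edges G \<longleftrightarrow> (f x, f y) \<in> edges H)"

text \<open>The notions below refer to new points, or to auxiliary spaces that are only fixed up to
  isomorphism. The vertex type is infinite so that all of these are available in it; every
  countable graph has an isomorphic copy in any such type.

  Contractible graphs and contractible transformations are the least pair of predicates closed
  under the following rules.\<close>

inductive contractible_graph :: "'a::infinite graph \<Rightarrow> bool"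
  and contractible_transformation :: "'a graph \<Rightarrow> 'a graph \<Rightarrow> bool"
where
  one_point:
    "contractible_graph \<lparr>pts = {x}, edges = {}\<rparr>"
| convert:
    "contractible_transformation G G' \<Longrightarrow> contractible_graph G' \<Longrightarrow> contractible_graph G"
| point_deletion:
    "digital_space G \<Longrightarrow> v \<in> pts G \<Longrightarrow> contractible_graph (rim G v) \<Longrightarrow>
     contractible_transformation G (delete_point G v)"
| point_gluing:
    "digital_space G \<Longrightarrow> v \<notin> pts G \<Longrightarrow> A \<subseteq> pts G \<Longrightarrow> contractible_graph (induced G A) \<Longrightarrow>
     contractible_transformation G
       \<lparr>pts = insert v (pts G), edges = edges G \<union> {v} \<times> A \<union> A \<times> {v}\<rparr>"
| edge_deletion:
    "digital_space G \<Longrightarrow> (u, v) \<in> edges G \<Longrightarrow>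
     contractible_graph (induced G (nbrs G u \<inter> nbrs G v)) \<Longrightarrow>
     contractible_transformation G \<lparr>pts = pts G, edges = edges G - {(u, v), (v, u)}\<rparr>"
| edge_addition:
    "digital_space G \<Longrightarrow> u \<in> pts G \<Longrightarrow> v \<in> pts G \<Longrightarrow> u \<noteq> v \<Longrightarrow> (u, v) \<notin> edges G \<Longrightarrow>
     contractible_graph (induced G (nbrs G u \<inter> nbrs G v)) \<Longrightarrow>
     contractible_transformation G \<lparr>pts = pts G, edges = edges G \<union> {(u, v), (v, u)}\<rparr>"

text \<open>The graph obtained from a disjoint union of \<open>D\<close> and \<open>C\<close> by identifying every point \<open>x\<close> of
  \<open>dD\<close> with the point \<open>f x\<close> of \<open>dC\<close>, where \<open>f\<close> is an isomorphism from \<open>dD\<close> to \<open>dC\<close>.\<close>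

definition attach ::
  "('a \<Rightarrow> 'a) \<Rightarrow> 'a graph \<Rightarrow> 'a graph \<Rightarrow> 'a graph \<Rightarrow> 'a graph \<Rightarrow> ('a + 'a) graph" where
  "attach f D dD C dC =
     (let h = (\<lambda>y. if y \<in> pts dC then Inl (inv_into (pts dD) f y) else Inr y)
      in \<lparr>pts = Inl ` pts D \<union> h ` pts C,
          edges = map_prod Inl Inl ` edges D \<union> map_prod h h ` edges C\<rparr>)"

text \<open>\<open>manifold_with_boundary n N dN\<close> and \<open>digital_disk n N dN\<close> say that \<open>N\<close> is an \<open>n\<close>-manifold
  with boundary, respectively an \<open>n\<close>-disk, and that the subspace \<open>dN\<close> is its boundary. The
  boundary of a 0-disk is empty by convention; it is never used.\<close>

inductive closed_manifold :: "nat \<Rightarrow> 'a::infinite graph \<Rightarrow> bool"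
  and manifold_with_boundary :: "nat \<Rightarrow> 'a graph \<Rightarrow> 'a graph \<Rightarrow> bool"
  and digital_disk :: "nat \<Rightarrow> 'a graph \<Rightarrow> 'a graph \<Rightarrow> bool"
  and digital_sphere :: "nat \<Rightarrow> 'a graph \<Rightarrow> bool"
where
  closed_manifold:
    "n \<ge> 1 \<Longrightarrow> digital_space M \<Longrightarrow> connected_graph M \<Longrightarrow>
     (\<forall>v\<in>pts M. digital_sphere (n - 1) (rim M v)) \<Longrightarrow>
     closed_manifold n M"
| manifold_with_boundary:
    "n \<ge> 1 \<Longrightarrow> digital_space N \<Longrightarrow> connected_graph N \<Longrightarrow>
     closed_manifold n M \<Longrightarrow> v \<in> pts M \<Longrightarrow> graph_iso f (delete_point M v) N \<Longrightarrow>
     manifold_with_boundary n N (induced N (f ` nbrs M v))"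
| disk_0:
    "digital_disk 0 \<lparr>pts = {x}, edges = {}\<rparr> \<lparr>pts = {}, edges = {}\<rparr>"
| disk_1:
    "digital_space N \<Longrightarrow> digital_sphere 1 S \<Longrightarrow> v \<in> pts S \<Longrightarrow>
     graph_iso f (delete_point S v) N \<Longrightarrow>
     digital_disk 1 N (induced N (f ` nbrs S v))"
| disk_n:
    "n \<ge> 2 \<Longrightarrow> manifold_with_boundary n N dN \<Longrightarrow> contractible_graph N \<Longrightarrow>
     digital_disk n N dN"
| sphere_0:
    "a \<noteq> b \<Longrightarrow> digital_sphere 0 \<lparr>pts = {a, b}, edges = {}\<rparr>"
| sphere_1:
    "digital_space G \<Longrightarrow> finite (pts G) \<Longrightarrow> connected_graph G \<Longrightarrow>
     (\<forall>v\<in>pts G. digital_sphere 0 (rim G v)) \<Longrightarrow>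
     digital_sphere 1 G"
| sphere_n:
    "n \<ge> 2 \<Longrightarrow> digital_space G \<Longrightarrow> digital_disk n D dD \<Longrightarrow> digital_disk n C dC \<Longrightarrow>
     graph_iso f dD dC \<Longrightarrow> graph_iso g (attach f D dD C dC) G \<Longrightarrow>
     digital_sphere n G"

definition interior_space :: "'a graph \<Rightarrow> 'a graph \<Rightarrow> 'a graph" where
  "interior_space N dN = induced N (pts N - pts dN)"

text \<open>The one-disk \<open>D\<close>, with boundary \<open>dD\<close>, is embedded in the two-manifold \<open>H\<close>.\<close>

definition embedded_one_disk :: "'a::infinite graph \<Rightarrow> 'a graph \<Rightarrow> 'a graph \<Rightarrow> bool" where
  "embedded_one_disk H D dD \<longleftrightarrow>
     digital_disk 1 D dD \<and> belongs_to D H \<and>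
     (\<exists>D2 dD2. digital_disk 2 D2 dD2 \<and> belongs_to D2 H \<and> belongs_to dD dD2 \<and>
        belongs_to (interior_space D dD) (interior_space D2 dD2))"

end

theory Submission
  imports Defs
begin

text \<open>The links of \<open>H\<close> are cycles of length at least four, so the clique complex of \<open>H\<close> is a
  closed triangulated surface, and contractible graphs carry no mod-two cohomology in degree one.

  Suppose some cocycle \<open>\<phi>\<close> of \<open>H\<close> is not a coboundary, and let \<open>a, p 0, \<dots>, p m\<close> be a closed
  walk of odd \<open>\<phi>\<close>-parity of minimal length. A 2-disk in which an induced path is embedded contains
  all neighbours of the inner points of the path, and \<open>\<phi>\<close> is a coboundary on it. Applied to paths
  \<open>y, p 0, \<dots>, p m\<close> with \<open>y\<close> next to \<open>a\<close> in the link of \<open>p 0\<close>, this forces \<open>y\<close> to be adjacent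
  to \<open>p m\<close> unless it is adjacent to \<open>p 1\<close>; rotating around the link of \<open>p 0\<close> from both ends then yields a
  shorter odd walk.

  So all cocycles of \<open>H\<close> are coboundaries. Deleting boundary points of \<open>H - v\<close> one at a time then
  never gets stuck: a stuck configuration splits \<open>H\<close> into two connected regions and a point whose
  link meets both of them in several arcs, and by a parity count of triangles this produces a
  nontrivial cocycle. Hence \<open>H - v\<close> is contractible, and \<open>H\<close> is the
  union of the disks \<open>H - v\<close> and star of \<open>v\<close>.\<close>

subsection \<open>Connectedness\<close>

text \<open>Contractibility is generated by transformations in both directions, so a given 2-disk
  comes with no order in which its points could be removed; what is drawn from its contractibility
  is an invariant that can be pulled back along all four transformations. Coefficients mod two are
  needed because of the projective plane, whose real first cohomology vanishes. At the other end a
  sphere has to be exhibited as a union of contractible graphs, so the vanishing must be turned back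
  into an order of deletion. The obstacle in between is that the hypothesis speaks of paths, while
  an odd closed walk is not a path. A disk around the inner points of a path also contains their
  neighbours, hence the missing point \<open>a\<close> as soon as \<open>p 0\<close> is inner; for
  this reason the path begins one point before \<open>p 0\<close>, at some \<open>y\<close> other
  than \<open>a\<close>. If the link of \<open>p 0\<close> has only four points, every
  \<open>y\<close> next to \<open>a\<close> in it is adjacent to \<open>p 1\<close> and no such path
  is induced; this explains the separate treatment of links of length four.\<close>

definition conn_on :: "('a \<times> 'a) set \<Rightarrow> 'a set \<Rightarrow> bool" where
  "conn_on E A \<longleftrightarrow> A \<noteq> {} \<and>
     (\<forall>X. X \<subseteq> A \<longrightarrow> X \<noteq> {} \<longrightarrow> (\<forall>x\<in>X. \<forall>y\<in>A. (x, y) \<in> E \<longrightarrow> y \<in> X) \<longrightarrow> X = A)"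

lemma conn_onD:
  assumes "conn_on E A" "X \<subseteq> A" "X \<noteq> {}" "\<And>x y. x \<in> X \<Longrightarrow> y \<in> A \<Longrightarrow> (x, y) \<in> E \<Longrightarrow> y \<in> X"
  shows "X = A"
  using assms unfolding conn_on_def by blast

text \<open>Connectedness is phrased by closed subsets instead of paths so that the points
  satisfying \<open>P\<close> can serve as the closed subset. \<open>E\<close> remains the edge
  relation of the ambient graph, whichever \<open>A\<close> is considered.\<close>

lemma conn_on_induct [consumes 3, case_names step]:
  assumes "conn_on E A" "x0 \<in> A" "P x0"
    and step: "\<And>x y. x \<in> A \<Longrightarrow> y \<in> A \<Longrightarrow> (x, y) \<in> E \<Longrightarrow> P x \<Longrightarrow> P y"
    and "z \<in> A"
  shows "P z"
proof -
  have "{x \<in> A. P x} = A"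
    by (rule conn_onD[OF assms(1)]) (use assms in auto)
  with \<open>z \<in> A\<close> show ?thesis by blast
qed

lemma conn_on_insert:
  assumes "conn_on E A" "a \<in> A" "(a, u) \<in> E" "(u, a) \<in> E"
  shows "conn_on E (insert u A)"
  unfolding conn_on_def
proof (intro conjI allI impI)
  fix X assume X: "X \<subseteq> insert u A" "X \<noteq> {}" "\<forall>x\<in>X. \<forall>y\<in>insert u A. (x, y) \<in> E \<longrightarrow> y \<in> X"
  have "X \<inter> A \<noteq> {}" using X assms by blast
  then have "X \<inter> A = A" using X by (intro conn_onD[OF assms(1)]) auto
  then show "X = insert u A" using X assms by blast
qed simp

lemma connected_graph_iff:
  assumes "digital_space G"
  shows "connected_graph G \<longleftrightarrow> conn_on (edges G) (pts G)"
proof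
  assume c: "connected_graph G"
  show "conn_on (edges G) (pts G)"
    unfolding conn_on_def
  proof (intro conjI allI impI)
    show "pts G \<noteq> {}" using c by (simp add: connected_graph_def)
    fix X assume X: "X \<subseteq> pts G" "X \<noteq> {}" "\<forall>x\<in>X. \<forall>y\<in>pts G. (x, y) \<in> edges G \<longrightarrow> y \<in> X"
    from X obtain a where a: "a \<in> X" by blast
    have "y \<in> X" if "y \<in> pts G" for y
    proof -
      have "(a, y) \<in> (edges G)\<^sup>*" using c a X that by (auto simp: connected_graph_def)
      then show ?thesis
        by (induction rule: rtrancl_induct) (use a X assms in \<open>auto simp: digital_space_def\<close>)
    qed
    with X show "X = pts G" by blast
  qed
next
  assume c: "conn_on (edges G) (pts G)"
  have "(u, v) \<in> (edges G)\<^sup>*" if "u \<in> pts G" "v \<in> pts G" for u v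
    using c that(1) _ _ that(2)
    by (rule conn_on_induct) (auto intro: rtrancl_into_rtrancl)
  then show "connected_graph G" using c by (auto simp: connected_graph_def conn_on_def)
qed

lemma conn_on_restrict: "conn_on (E \<inter> A \<times> A) A \<longleftrightarrow> conn_on E A"
  unfolding conn_on_def by blast

lemma pts_induced [simp]: "pts (induced G A) = A \<inter> pts G"
  and edges_induced [simp]: "edges (induced G A) = edges G \<inter> (A \<times> A)"
  by (simp_all add: induced_def)

lemma digital_space_induced: "digital_space G \<Longrightarrow> digital_space (induced G A)"
  by (auto simp: digital_space_def sym_def irrefl_def intro: countable_subset)

lemma induced_induced: "induced (induced G A) B = induced G (A \<inter> B)"
  by (auto simp: induced_def)

lemma connected_induced_iff:
  assumes "digital_space G" "A \<subseteq> pts G"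
  shows "connected_graph (induced G A) \<longleftrightarrow> conn_on (edges G) A"
  using connected_graph_iff[OF digital_space_induced[OF assms(1)], of A] assms(2)
  by (simp add: Int_absorb2 conn_on_restrict)

lemma edgesD:
  assumes "digital_space G" "(x, y) \<in> edges G"
  shows "x \<in> pts G" "y \<in> pts G" "(y, x) \<in> edges G" "x \<noteq> y"
  using assms by (auto simp: digital_space_def sym_def irrefl_def)

lemma nbrs_subset: "digital_space G \<Longrightarrow> nbrs G v \<subseteq> pts G"
  by (auto simp: nbrs_def dest: edgesD)

subsection \<open>One-spheres are cycles\<close>

text \<open>The last two disjuncts close the cycle. The bound 4 excludes triangles: the two
  neighbours of a point of a 1-sphere are not adjacent.\<close>

definition cycle_enum :: "'a graph \<Rightarrow> nat \<Rightarrow> (nat \<Rightarrow> 'a) \<Rightarrow> bool" where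
  "cycle_enum S n c \<longleftrightarrow> n \<ge> 4 \<and> pts S = c ` {..<n} \<and> inj_on c {..<n} \<and>
     (\<forall>i<n. \<forall>j<n. (c i, c j) \<in> edges S \<longleftrightarrow>
        j = Suc i \<or> i = Suc j \<or> (i = 0 \<and> j = n - 1) \<or> (j = 0 \<and> i = n - 1))"

lemma sphere0E:
  assumes "digital_sphere 0 S"
  obtains a b where "a \<noteq> b" "pts S = {a, b}" "edges S = {}"
  using assms by (cases rule: digital_sphere.cases) auto

lemma sphere1D:
  assumes "digital_sphere 1 S"
  shows "digital_space S" "finite (pts S)" "connected_graph S"
    "v \<in> pts S \<Longrightarrow> digital_sphere 0 (rim S v)"
  using assms by (auto elim: digital_sphere.cases)

lemma sphere1_nbrs:
  assumes "digital_sphere 1 S" "v \<in> pts S"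
  obtains a b where "a \<noteq> b" "nbrs S v = {a, b}" "(a, b) \<notin> edges S"
proof -
  from sphere1D(4)[OF assms] obtain a b
    where ab: "a \<noteq> b" "pts (rim S v) = {a, b}" "edges (rim S v) = {}"
    by (rule sphere0E)
  have "nbrs S v = {a, b}"
    using ab(2) nbrs_subset[OF sphere1D(1)[OF assms(1)], of v] by (simp add: rim_def Int_absorb2)
  moreover have "(a, b) \<notin> edges S" using ab(3) calculation by (auto simp: rim_def)
  ultimately show ?thesis using ab(1) that by blast
qed

text \<open>Walking on without turning back must return, and every point has just two neighbours, so
  the first repetition is at the start; the points visited are closed under adjacency and hence all
  of them.\<close>

lemma sphere1_cycle_enum:
  assumes S: "digital_sphere 1 S" and x0: "x0 \<in> pts S"
  obtains n c where "cycle_enum S n c" "c 0 = x0"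
proof -
  note ds = sphere1D(1)[OF S]
  define nxt where "nxt p x = (SOME y. (x, y) \<in> edges S \<and> y \<noteq> p)" for p x
  have nxt: "(x, nxt p x) \<in> edges S \<and> nxt p x \<noteq> p" if x: "x \<in> pts S" for p x
  proof -
    obtain a b where "a \<noteq> b" "nbrs S x = {a, b}" using sphere1_nbrs[OF S x] by metis
    then have "\<exists>y. (x, y) \<in> edges S \<and> y \<noteq> p" unfolding nbrs_def by (cases "a = p") auto
    then show ?thesis unfolding nxt_def by (rule someI_ex)
  qed
  \<comment> \<open>A state consists of the previous and the current point. In
    \<open>nxt x0 x0\<close> the point \<open>x0\<close> is a dummy predecessor of itself, which
    rules out nothing because no point is its own neighbour.\<close>
  define d where "d k = ((\<lambda>(p, x). (x, nxt p x)) ^^ k) (x0, nxt x0 x0)" for k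
  define c where "c k = fst (d k)" for k
  have dS: "d (Suc k) = (snd (d k), nxt (fst (d k)) (snd (d k)))" for k
    by (simp add: d_def case_prod_beta)
  have c0: "c 0 = x0" by (simp add: c_def d_def)
  have cS: "c (Suc k) = snd (d k)" for k by (simp add: c_def dS)
  have cSS: "c (Suc (Suc k)) = nxt (c k) (c (Suc k))" for k
    by (simp add: c_def dS)
  have cp: "c k \<in> pts S \<and> (c k, c (Suc k)) \<in> edges S" for k
  proof (induction k)
    case 0
    show ?case using nxt[OF x0, of x0] x0 c0 cS[of 0] by (simp add: d_def)
  next
    case (Suc k)
    then have "c (Suc k) \<in> pts S" using edgesD[OF ds] by blast
    with nxt[OF this, of "c k"] cSS show ?case by simp
  qed
  have c2: "c (Suc (Suc k)) \<noteq> c k" for k using cSS nxt cp by simp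
  have nb: "nbrs S (c (Suc k)) = {c k, c (Suc (Suc k))}" for k
  proof -
    obtain a b where ab: "nbrs S (c (Suc k)) = {a, b}" using sphere1_nbrs[OF S] cp by metis
    have "c k \<in> nbrs S (c (Suc k))" "c (Suc (Suc k)) \<in> nbrs S (c (Suc k))"
      using cp edgesD(3)[OF ds] by (auto simp: nbrs_def)
    with ab c2[of k] show ?thesis by auto
  qed
  have nad: "(c k, c (Suc (Suc k))) \<notin> edges S" for k
  proof -
    obtain a b where "nbrs S (c (Suc k)) = {a, b}" "(a, b) \<notin> edges S"
      using sphere1_nbrs[OF S] cp by metis
    with nb[of k] edgesD(3)[OF ds] c2[of k] show ?thesis by (auto simp: doubleton_eq_iff)
  qed
  have "\<not> inj c"
    using sphere1D(2)[OF S] cp by (metis finite_subset image_subsetI infinite_UNIV_nat finite_imageD)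
  then have "\<exists>n. \<exists>j<n. c n = c j" unfolding inj_def by (metis linorder_neqE_nat)
  define n where "n = (LEAST n. \<exists>j<n. c n = c j)"
  have "\<exists>j<n. c n = c j" unfolding n_def by (rule LeastI_ex) fact
  then obtain j where j: "j < n" "c n = c j" by blast
  have inj': "c i \<noteq> c k" if "i < k" "k < n" for i k
    using that not_less_Least[of k "\<lambda>n. \<exists>j<n. c n = c j"] unfolding n_def by metis
  then have inj: "inj_on c {..<n}" by (auto simp: inj_on_def) (metis linorder_neqE_nat)
  \<comment> \<open>Meeting the walk at \<open>c j\<close> with \<open>j > 0\<close> would make
    \<open>c (n - 1)\<close> one of the two known neighbours of \<open>c j\<close>, a repetition
    that occurs too early or violates \<open>c2\<close> or irreflexivity.\<close>
  have "j = 0"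
  proof (rule ccontr)
    assume "j \<noteq> 0"
    then obtain j' where j': "j = Suc j'" using not0_implies_Suc by blast
    obtain n' where n': "n = Suc n'" using j by (cases n) auto
    have "c n' \<in> nbrs S (c (Suc j'))"
      using cp[of n'] edgesD(3)[OF ds] j j' n' by (auto simp: nbrs_def)
    then have "c n' = c j' \<or> c n' = c (Suc (Suc j'))" using nb by auto
    then show False
    proof
      assume "c n' = c j'"
      then show False using inj'[of j' n'] j j' n' by simp
    next
      assume eq: "c n' = c (Suc (Suc j'))"
      consider "Suc (Suc j') < n'" | "Suc (Suc j') = n'" | "n' = Suc j'" using j j' n' by linarith
      then show False
      proof cases
        case 1 then show False using inj'[of "Suc (Suc j')" n'] eq n' by simp
      next
        case 2 then show False using j j' n' c2[of "Suc j'"] by metis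
      next
        case 3 then show False using j j' n' cp[of n'] edgesD(4)[OF ds] by metis
      qed
    qed
  qed
  with j have cn: "c n = c 0" "n > 0" by auto
  have n1: "n \<noteq> 1" using cn cp[of 0] edgesD(4)[OF ds, of "c 0" "c 0"] by auto
  have n2: "n \<noteq> 2" using cn c2[of 0] by (auto simp: numeral_2_eq_2)
  have n3: "n \<noteq> 3"
    using cn nad[of 1] cp[of 0] edgesD(3)[OF ds] by (auto simp: numeral_3_eq_3)
  have n4: "n \<ge> 4" using cn n1 n2 n3 by linarith
  have nb0: "nbrs S (c 0) = {c (n - 1), c 1}"
  proof -
    obtain a b where ab: "nbrs S (c 0) = {a, b}" using sphere1_nbrs[OF S] cp by metis
    have "c 1 \<in> nbrs S (c 0)" using cp[of 0] by (simp add: nbrs_def)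
    moreover have "c (n - 1) \<in> nbrs S (c 0)"
      using cp[of "n - 1"] cn edgesD(3)[OF ds] by (auto simp: nbrs_def)
    moreover have "c (n - 1) \<noteq> c 1"
    proof -
      have "1 < n - 1" "n - 1 < n" using n4 by linarith+
      from inj'[OF this] show ?thesis by metis
    qed
    ultimately show ?thesis using ab by auto
  qed
  have nb': "nbrs S (c i) = {c (if i = 0 then n - 1 else i - 1), c (if i = n - 1 then 0 else Suc i)}"
    if "i < n" for i
  proof (cases i)
    case 0 then show ?thesis using nb0 n4 by simp
  next
    case (Suc k)
    then show ?thesis using nb[of k] cn n4 that by auto
  qed
  have E: "(c i, c k) \<in> edges S \<longleftrightarrow> k = Suc i \<or> i = Suc k \<or> (i = 0 \<and> k = n - 1) \<or> (k = 0 \<and> i = n - 1)"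
    if "i < n" "k < n" for i k
  proof -
    have "(c i, c k) \<in> edges S \<longleftrightarrow> c k \<in> nbrs S (c i)" by (simp add: nbrs_def)
    also have "\<dots> \<longleftrightarrow> k = (if i = 0 then n - 1 else i - 1) \<or> k = (if i = n - 1 then 0 else Suc i)"
      unfolding nb'[OF that(1)] using that n4 by (auto simp: inj_on_eq_iff[OF inj])
    also have "\<dots> \<longleftrightarrow> k = Suc i \<or> i = Suc k \<or> (i = 0 \<and> k = n - 1) \<or> (k = 0 \<and> i = n - 1)"
      using that n4 by auto
    finally show ?thesis .
  qed
  have "c ` {..<n} = pts S"
  proof (rule conn_onD)
    show "conn_on (edges S) (pts S)" using sphere1D(3)[OF S] connected_graph_iff[OF ds] by simp
    show "c ` {..<n} \<subseteq> pts S" using cp by blast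
    show "c ` {..<n} \<noteq> {}" using cn by auto
    fix x y assume "x \<in> c ` {..<n}" "(x, y) \<in> edges S"
    then obtain i where i: "i < n" "y \<in> nbrs S (c i)" by (auto simp: nbrs_def)
    then show "y \<in> c ` {..<n}" using nb'[OF i(1)] n4 by (auto split: if_splits)
  qed
  then have "cycle_enum S n c" unfolding cycle_enum_def using n4 inj E by auto
  with c0 that show ?thesis by blast
qed

lemma cycle_enum_sphere1:
  assumes ds: "digital_space S" and cyc: "cycle_enum S n c"
  shows "digital_sphere 1 S"
proof (rule sphere_1[OF ds])
  have n4: "n \<ge> 4" and P: "pts S = c ` {..<n}" and inj: "inj_on c {..<n}"
    and E: "\<And>i j. i < n \<Longrightarrow> j < n \<Longrightarrow> (c i, c j) \<in> edges S \<longleftrightarrow>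
        j = Suc i \<or> i = Suc j \<or> (i = 0 \<and> j = n - 1) \<or> (j = 0 \<and> i = n - 1)"
    using cyc unfolding cycle_enum_def by blast+
  show "finite (pts S)" using P by simp
  have r: "(c 0, c i) \<in> (edges S)\<^sup>*" if "i < n" for i
    using that
  proof (induction i)
    case (Suc i)
    then show ?case using E[of i "Suc i"] by (auto intro: rtrancl_into_rtrancl)
  qed simp
  have "sym ((edges S)\<^sup>*)" using ds by (auto simp: digital_space_def intro: sym_rtrancl)
  then have "(c i, c j) \<in> (edges S)\<^sup>*" if "i < n" "j < n" for i j
    using r[OF that(1)] r[OF that(2)] by (meson rtrancl_trans symD)
  then show "connected_graph S" using P n4 by (auto simp: connected_graph_def lessThan_empty_iff)
  show "\<forall>v\<in>pts S. digital_sphere 0 (rim S v)"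
  proof
    fix v assume "v \<in> pts S"
    then obtain i where i: "i < n" "v = c i" using P by auto
    define a where "a = (if i = 0 then n - 1 else i - 1)"
    define b where "b = (if i = n - 1 then 0 else Suc i)"
    have ab: "a < n" "b < n" "a \<noteq> b" using i n4 by (auto simp: a_def b_def)
    have "k = a \<or> k = b" if "k < n" "(c i, c k) \<in> edges S" for k
      using that i n4 by (auto simp: E a_def b_def)
    moreover have "(c i, c a) \<in> edges S" "(c i, c b) \<in> edges S"
      using i ab n4 by (auto simp: E a_def b_def)
    ultimately have nb: "nbrs S v = {c a, c b}"
      using nbrs_subset[OF ds, of v] i unfolding P nbrs_def by blast
    have "(c a, c b) \<notin> edges S" "(c b, c a) \<notin> edges S"
      using ab i n4 by (auto simp: E a_def b_def split: if_splits)
    moreover have "(x, x) \<notin> edges S" for x using edgesD(4)[OF ds] by blast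
    ultimately have "edges S \<inter> {c a, c b} \<times> {c a, c b} = {}" by blast
    then have "rim S v = \<lparr>pts = {c a, c b}, edges = {}\<rparr>"
      using nb nbrs_subset[OF ds, of v] by (simp add: rim_def induced_def Int_absorb2)
    moreover have "c a \<noteq> c b" using ab inj by (simp add: inj_on_eq_iff)
    ultimately show "digital_sphere 0 (rim S v)" using sphere_0 by metis
  qed
qed

subsection \<open>Contractible graphs have no mod-two cohomology in degree one\<close>

text \<open>One-cochains of the clique complex over the field of two elements, with
  \<open>\<noteq>\<close> on \<open>bool\<close> as addition. On non-adjacent pairs the values are
  arbitrary up to symmetry.\<close>

definition cocycle :: "'a graph \<Rightarrow> ('a \<Rightarrow> 'a \<Rightarrow> bool) \<Rightarrow> bool" where
  "cocycle G \<phi> \<longleftrightarrow> (\<forall>x y. \<phi> x y = \<phi> y x) \<and>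
     (\<forall>x y z. (x, y) \<in> edges G \<longrightarrow> (y, z) \<in> edges G \<longrightarrow> (x, z) \<in> edges G \<longrightarrow>
        \<phi> x z = (\<phi> x y \<noteq> \<phi> y z))"

definition coboundary :: "'a graph \<Rightarrow> ('a \<Rightarrow> 'a \<Rightarrow> bool) \<Rightarrow> bool" where
  "coboundary G \<phi> \<longleftrightarrow> (\<exists>f :: 'a \<Rightarrow> bool. \<forall>(x, y)\<in>edges G. \<phi> x y = (f x \<noteq> f y))"

text \<open>Vanishing of reduced cohomology in degrees zero and one. Degree zero is carried along
  because the arguments below transport values along connected rims and connected common
  neighbourhoods.\<close>

definition coh_trivial :: "'a graph \<Rightarrow> bool" where
  "coh_trivial G \<longleftrightarrow> conn_on (edges G) (pts G) \<and> (\<forall>\<phi>. cocycle G \<phi> \<longrightarrow> coboundary G \<phi>)"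

lemma coh_trivialD:
  fixes G :: "'a graph"
  assumes "coh_trivial G" "cocycle G \<phi>"
  shows "\<exists>f :: 'a \<Rightarrow> bool. \<forall>x y. (x, y) \<in> edges G \<longrightarrow> \<phi> x y = (f x \<noteq> f y)"
proof -
  have "coboundary G \<phi>" using assms by (simp add: coh_trivial_def)
  then show ?thesis unfolding coboundary_def by (simp add: split_def Ball_def)
qed

lemma cocycleD:
  assumes "cocycle G \<phi>"
  shows "\<phi> x y = \<phi> y x"
    "(x, y) \<in> edges G \<Longrightarrow> (y, z) \<in> edges G \<Longrightarrow> (x, z) \<in> edges G \<Longrightarrow> \<phi> x z = (\<phi> x y \<noteq> \<phi> y z)"
  using assms by (auto simp: cocycle_def)

lemma cocycle_mono: "cocycle G \<phi> \<Longrightarrow> edges G' \<subseteq> edges G \<Longrightarrow> cocycle G' \<phi>"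
  unfolding cocycle_def by blast

section \<open>Pulling \<open>coh_trivial\<close> back along the four transformations\<close>

lemma coh_trivial_point_deletion:
  fixes G :: "'a graph"
  assumes G: "digital_space G" "v \<in> pts G"
    and rim: "conn_on (edges (rim G v)) (pts (rim G v))"
    and triv: "coh_trivial (delete_point G v)"
  shows "coh_trivial G"
proof -
  let ?N = "nbrs G v"
  have N: "?N \<subseteq> pts G - {v}" using nbrs_subset[OF G(1)] edgesD(4)[OF G(1)] by (auto simp: nbrs_def)
  have rim': "conn_on (edges G) ?N"
    using rim N by (simp add: rim_def Int_absorb2 conn_on_restrict Diff_subset_conv subset_trans)
  have del: "conn_on (edges G) (pts G - {v})"
    using triv by (simp add: coh_trivial_def delete_point_def Int_absorb2 conn_on_restrict)
  obtain a where a: "a \<in> ?N" using rim' by (auto simp: conn_on_def)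
  have "conn_on (edges G) (insert v (pts G - {v}))"
    by (rule conn_on_insert[OF del, of a]) (use a N edgesD(3)[OF G(1)] in \<open>auto simp: nbrs_def\<close>)
  moreover have "insert v (pts G - {v}) = pts G" using G(2) by blast
  ultimately have conn: "conn_on (edges G) (pts G)" by simp
  have "coboundary G \<phi>" if \<phi>: "cocycle G \<phi>" for \<phi>
  proof -
    have "cocycle (delete_point G v) \<phi>"
      by (rule cocycle_mono[OF \<phi>]) (auto simp: delete_point_def)
    from coh_trivialD[OF triv this]
    obtain f :: "'a \<Rightarrow> bool" where f: "\<forall>x y. (x, y) \<in> edges (delete_point G v) \<longrightarrow> \<phi> x y = (f x \<noteq> f y)" by (rule exE)
    note f = f[rule_format]
    have f': "\<phi> x y = (f x \<noteq> f y)" if "(x, y) \<in> edges G" "x \<noteq> v" "y \<noteq> v" for x y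
      using f[of x y] that edgesD[OF G(1) that(1)] by (simp add: delete_point_def)
    \<comment> \<open>The value at \<open>v\<close> is forced by any single neighbour; the triangles
      at \<open>v\<close> carry it unchanged along the edges of the connected rim.\<close>
    define b where "b = (f a \<noteq> \<phi> v a)"
    have b: "b = (f x \<noteq> \<phi> v x)" if "x \<in> ?N" for x
      using that
    proof (rule conn_on_induct[where P = "\<lambda>x. b = (f x \<noteq> \<phi> v x)", OF rim' a b_def, rotated])
      fix x y assume xy: "x \<in> ?N" "y \<in> ?N" "(x, y) \<in> edges G" "b = (f x \<noteq> \<phi> v x)"
      then have "\<phi> v y = (\<phi> v x \<noteq> \<phi> x y)" using cocycleD(2)[OF \<phi>] by (simp add: nbrs_def)
      moreover have "\<phi> x y = (f x \<noteq> f y)" using f' xy N by blast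
      ultimately show "b = (f y \<noteq> \<phi> v y)" using xy(4) by auto
    qed
    have "\<phi> x y = ((f(v := b)) x \<noteq> (f(v := b)) y)" if xy: "(x, y) \<in> edges G" for x y
    proof (cases "x = v \<or> y = v")
      case False then show ?thesis using f'[OF xy] by simp
    next
      case True
      then show ?thesis
      proof
        assume "x = v"
        then show ?thesis using b[of y] xy edgesD(4)[OF G(1) xy] by (auto simp: nbrs_def)
      next
        assume "y = v"
        then show ?thesis
          using b[of x] xy edgesD(3,4)[OF G(1) xy] cocycleD(1)[OF \<phi>, of x v] by (auto simp: nbrs_def)
      qed
    qed
    then show ?thesis unfolding coboundary_def by blast
  qed
  with conn show ?thesis by (simp add: coh_trivial_def)
qed

text \<open>Triviality is known for the larger graph, so \<open>\<phi>\<close> has to be extended to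
  the new edges. A primitive \<open>g\<close> of \<open>\<phi>\<close> on \<open>A\<close> supplies
  the values, and the cocycle condition on a triangle at \<open>v\<close> becomes the equation for
  \<open>g\<close>.\<close>

lemma coh_trivial_point_gluing:
  fixes G :: "'a graph"
  assumes G: "digital_space G" "v \<notin> pts G" "A \<subseteq> pts G"
    and A: "coh_trivial (induced G A)"
    and triv: "coh_trivial \<lparr>pts = insert v (pts G), edges = edges G \<union> {v} \<times> A \<union> A \<times> {v}\<rparr>"
      (is "coh_trivial ?G'")
  shows "coh_trivial G"
proof -
  have conn': "conn_on (edges ?G') (insert v (pts G))"
    using triv by (simp add: coh_trivial_def)
  have connA: "conn_on (edges G) A"
    using A G(3) by (simp add: coh_trivial_def Int_absorb2 conn_on_restrict)
  have nv: "x \<noteq> v" "y \<noteq> v" if "(x, y) \<in> edges G" for x y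
    using edgesD(1,2)[OF G(1) that] G(2) by blast+
  have conn: "conn_on (edges G) (pts G)"
    unfolding conn_on_def
  proof (intro conjI allI impI)
    show "pts G \<noteq> {}" using connA G(3) by (auto simp: conn_on_def)
    fix X assume X: "X \<subseteq> pts G" "X \<noteq> {}" "\<forall>x\<in>X. \<forall>y\<in>pts G. (x, y) \<in> edges G \<longrightarrow> y \<in> X"
    show "X = pts G"
    \<comment> \<open>A closed set missing \<open>A\<close> stays closed in the larger graph; one
      meeting \<open>A\<close> contains all of it and becomes closed there once \<open>v\<close> is
      added.\<close>
    proof (cases "A \<inter> X = {}")
      case True
      have "X = insert v (pts G)"
      proof (rule conn_onD[OF conn'])
        fix x y assume h: "x \<in> X" "y \<in> insert v (pts G)" "(x, y) \<in> edges ?G'"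
        then have "(x, y) \<in> edges G" using True X(1) G(2) by auto
        then show "y \<in> X" using X(3) h(1) edgesD(2)[OF G(1)] by blast
      qed (use X in auto)
      with X(1) G(2) show ?thesis by blast
    next
      case False
      have "A \<inter> X = A"
        by (rule conn_onD[OF connA]) (use X False G in auto)
      have eq: "insert v X = insert v (pts G)"
      proof (rule conn_onD[OF conn'])
        fix x y assume h: "x \<in> insert v X" "y \<in> insert v (pts G)" "(x, y) \<in> edges ?G'"
        then consider "y = v" | "y \<in> A" | "(x, y) \<in> edges G" by auto
        then show "y \<in> insert v X"
        proof cases
          case 3
          then have "x \<in> X" "y \<in> pts G" using h(1) edgesD(2)[OF G(1)] nv by blast+
          then show ?thesis using X(3) 3 by blast
        qed (use \<open>A \<inter> X = A\<close> in blast)+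
      qed (use X in auto)
      show ?thesis using X(1) G(2) insert_ident[of v X "pts G"] eq by blast
    qed
  qed
  have "coboundary G \<phi>" if \<phi>: "cocycle G \<phi>" for \<phi>
  proof -
    have "cocycle (induced G A) \<phi>" by (rule cocycle_mono[OF \<phi>]) auto
    from coh_trivialD[OF A this]
    obtain g :: "'a \<Rightarrow> bool" where g: "\<forall>x y. (x, y) \<in> edges (induced G A) \<longrightarrow> \<phi> x y = (g x \<noteq> g y)" by (rule exE)
    note g = g[rule_format]
    define \<psi> where "\<psi> = (\<lambda>x y. if x = v \<and> y = v then False else if x = v then g y else if y = v then g x else \<phi> x y)"
    have "cocycle ?G' \<psi>"
      unfolding cocycle_def
    proof (intro conjI allI impI)
      show "\<psi> x y = \<psi> y x" for x y using cocycleD(1)[OF \<phi>] by (auto simp: \<psi>_def)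
      have E: "(x \<noteq> v \<and> y \<noteq> v \<and> (x, y) \<in> edges G) \<or> (x = v \<and> y \<noteq> v \<and> y \<in> A) \<or> (y = v \<and> x \<noteq> v \<and> x \<in> A)"
        if "(x, y) \<in> edges ?G'" for x y
        using that nv G(2,3) by auto
      have g': "\<phi> x y = (g x \<noteq> g y)" if "(x, y) \<in> edges G" "x \<in> A" "y \<in> A" for x y
        using g[of x y] that by simp
      fix x y z assume "(x, y) \<in> edges ?G'" "(y, z) \<in> edges ?G'" "(x, z) \<in> edges ?G'"
      note h = E[OF this(1)] E[OF this(2)] E[OF this(3)]
      consider "x = v" | "y = v" | "z = v" | "x \<noteq> v" "y \<noteq> v" "z \<noteq> v" by blast
      then show "\<psi> x z = (\<psi> x y \<noteq> \<psi> y z)"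
      proof cases
        case 1
        with h have "y \<noteq> v" "z \<noteq> v" "y \<in> A" "z \<in> A" "(y, z) \<in> edges G" by blast+
        with 1 g'[of y z] show ?thesis by (auto simp: \<psi>_def)
      next
        case 2
        with h have "x \<noteq> v" "z \<noteq> v" "x \<in> A" "z \<in> A" "(x, z) \<in> edges G" by blast+
        with 2 g'[of x z] show ?thesis by (auto simp: \<psi>_def)
      next
        case 3
        with h have "y \<noteq> v" "x \<noteq> v" "y \<in> A" "x \<in> A" "(x, y) \<in> edges G" by blast+
        with 3 g'[of x y] show ?thesis by (auto simp: \<psi>_def)
      next
        case 4
        with h have "(x, y) \<in> edges G" "(y, z) \<in> edges G" "(x, z) \<in> edges G" by blast+
        with 4 cocycleD(2)[OF \<phi>, of x y z] show ?thesis by (simp add: \<psi>_def)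
      qed
    qed
    from coh_trivialD[OF triv this]
    obtain f :: "'a \<Rightarrow> bool" where f: "\<forall>x y. (x, y) \<in> edges ?G' \<longrightarrow> \<psi> x y = (f x \<noteq> f y)" by (rule exE)
    note f = f[rule_format]
    have "\<phi> x y = (f x \<noteq> f y)" if "(x, y) \<in> edges G" for x y
      using f[of x y] nv[OF that] that by (simp add: \<psi>_def)
    then show ?thesis unfolding coboundary_def by blast
  qed
  with conn show ?thesis by (simp add: coh_trivial_def)
qed

text \<open>The ends have a common neighbour \<open>w\<close>, and the triangle \<open>u\<close>,
  \<open>v\<close>, \<open>w\<close> recovers \<open>\<phi>\<close> on the deleted edge from the two
  edges that remain.\<close>

lemma coh_trivial_edge_deletion:
  fixes G :: "'a graph"
  assumes G: "digital_space G" "(u, v) \<in> edges G"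
    and A: "coh_trivial (induced G (nbrs G u \<inter> nbrs G v))"
    and triv: "coh_trivial \<lparr>pts = pts G, edges = edges G - {(u, v), (v, u)}\<rparr>" (is "coh_trivial ?G'")
  shows "coh_trivial G"
proof -
  have conn: "conn_on (edges G) (pts G)"
    using triv unfolding coh_trivial_def conn_on_def by auto
  obtain w where w: "w \<in> nbrs G u" "w \<in> nbrs G v"
    using A by (auto simp: coh_trivial_def conn_on_def)
  have w': "(u, w) \<in> edges G" "(v, w) \<in> edges G" "(w, v) \<in> edges G" "w \<noteq> u" "w \<noteq> v" "u \<noteq> v"
    using w edgesD(3,4)[OF G(1)] G(2) by (auto simp: nbrs_def)
  have "coboundary G \<phi>" if \<phi>: "cocycle G \<phi>" for \<phi>
  proof -
    have "cocycle ?G' \<phi>" by (rule cocycle_mono[OF \<phi>]) auto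
    from coh_trivialD[OF triv this]
    obtain f :: "'a \<Rightarrow> bool" where f: "\<forall>x y. (x, y) \<in> edges ?G' \<longrightarrow> \<phi> x y = (f x \<noteq> f y)" by (rule exE)
    note f = f[rule_format]
    have "\<phi> u v = (f u \<noteq> f v)"
      using f[of u w] f[of w v] w' cocycleD(2)[OF \<phi> w'(1) w'(3) G(2)] by auto
    then have "\<phi> x y = (f x \<noteq> f y)" if "(x, y) \<in> edges G" for x y
      using f[of x y] that cocycleD(1)[OF \<phi>, of u v]
      by (cases "(x, y) = (u, v) \<or> (x, y) = (v, u)") auto
    then show ?thesis unfolding coboundary_def by blast
  qed
  with conn show ?thesis by (simp add: coh_trivial_def)
qed

lemma coh_trivial_edge_addition:
  fixes G :: "'a graph"
  assumes G: "digital_space G" "u \<in> pts G" "v \<in> pts G" "u \<noteq> v" "(u, v) \<notin> edges G"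
    and A: "coh_trivial (induced G (nbrs G u \<inter> nbrs G v))"
    and triv: "coh_trivial \<lparr>pts = pts G, edges = edges G \<union> {(u, v), (v, u)}\<rparr>" (is "coh_trivial ?G'")
  shows "coh_trivial G"
proof -
  let ?A = "nbrs G u \<inter> nbrs G v"
  have connA: "conn_on (edges G) ?A"
    using A nbrs_subset[OF G(1), of u]
    by (simp add: coh_trivial_def Int_absorb2 conn_on_restrict le_infI1)
  obtain w where w: "w \<in> ?A" using connA by (auto simp: conn_on_def)
  have w': "(u, w) \<in> edges G" "(v, w) \<in> edges G" "(w, u) \<in> edges G" "(w, v) \<in> edges G" "w \<in> pts G"
    using w edgesD(2,3)[OF G(1)] by (auto simp: nbrs_def)
  have conn': "conn_on (edges ?G') (pts G)" using triv by (simp add: coh_trivial_def)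
  have conn: "conn_on (edges G) (pts G)"
    unfolding conn_on_def
  proof (intro conjI allI impI)
    show "pts G \<noteq> {}" using G by auto
    fix X assume X: "X \<subseteq> pts G" "X \<noteq> {}" "\<forall>x\<in>X. \<forall>y\<in>pts G. (x, y) \<in> edges G \<longrightarrow> y \<in> X"
    show "X = pts G"
    proof (rule conn_onD[OF conn' X(1,2)])
      fix x y assume h: "x \<in> X" "y \<in> pts G" "(x, y) \<in> edges ?G'"
      then consider "(x, y) \<in> edges G" | "(x, w) \<in> edges G" "(w, y) \<in> edges G"
        using w' by auto
      then show "y \<in> X" using X(3) h(1,2) w'(5) by cases blast+
    qed
  qed
  have "coboundary G \<phi>" if \<phi>: "cocycle G \<phi>" for \<phi>
  proof -
    \<comment> \<open>The value on the new edge is read off a detour over a common neighbour.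
      Connectedness of the common neighbourhood makes it independent of the detour, so all new
      triangles are consistent.\<close>
    define b where "b = (\<phi> u w \<noteq> \<phi> w v)"
    have b: "b = (\<phi> u x \<noteq> \<phi> x v)" if "x \<in> ?A" for x
      using that
    proof (rule conn_on_induct[where P = "\<lambda>x. b = (\<phi> u x \<noteq> \<phi> x v)", OF connA w b_def, rotated])
      fix x y assume xy: "x \<in> ?A" "y \<in> ?A" "(x, y) \<in> edges G" "b = (\<phi> u x \<noteq> \<phi> x v)"
      then have "\<phi> u y = (\<phi> u x \<noteq> \<phi> x y)" "\<phi> v y = (\<phi> v x \<noteq> \<phi> x y)"
        using cocycleD(2)[OF \<phi>] by (simp_all add: nbrs_def)
      then show "b = (\<phi> u y \<noteq> \<phi> y v)"
        using xy(4) cocycleD(1)[OF \<phi>, of v y] cocycleD(1)[OF \<phi>, of v x] by auto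
    qed
    define \<psi> where "\<psi> = (\<lambda>x y. if {x, y} = {u, v} then b else \<phi> x y)"
    have sym: "\<psi> x y = \<psi> y x" for x y
      using cocycleD(1)[OF \<phi>, of x y] by (auto simp: \<psi>_def insert_commute)
    have eu: "\<psi> x z = (\<psi> x y \<noteq> \<psi> y z)"
      if "{x, z} = {u, v}" "(x, y) \<in> edges G" "(y, z) \<in> edges G" for x y z
    proof -
      have "y \<in> ?A" using that edgesD(3)[OF G(1)] by (auto simp: nbrs_def doubleton_eq_iff)
      then have "b = (\<phi> u y \<noteq> \<phi> y v)" using b by blast
      moreover have "y \<noteq> x" "y \<noteq> z" using that edgesD(4)[OF G(1)] by blast+
      then have "{x, y} \<noteq> {u, v}" "{y, z} \<noteq> {u, v}"
        using that(1) by (auto simp: doubleton_eq_iff)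
      then have "\<psi> x y = \<phi> x y" "\<psi> y z = \<phi> y z" "\<psi> x z = b"
        using that(1) by (simp_all add: \<psi>_def)
      moreover have "x = u \<and> z = v \<or> x = v \<and> z = u" using that(1) by (simp add: doubleton_eq_iff)
      ultimately show ?thesis using cocycleD(1)[OF \<phi>] by metis
    qed
    have E': "(x, y) \<in> edges ?G' \<longleftrightarrow> (x, y) \<in> edges G \<or> {x, y} = {u, v}" for x y
      by (auto simp: doubleton_eq_iff)
    have "cocycle ?G' \<psi>"
      unfolding cocycle_def
    proof (intro conjI allI impI)
      show "\<psi> x y = \<psi> y x" for x y by (rule sym)
      fix x y z assume h: "(x, y) \<in> edges ?G'" "(y, z) \<in> edges ?G'" "(x, z) \<in> edges ?G'"
      have ir: "(x, x) \<notin> edges ?G'" for x using edgesD(4)[OF G(1)] G(4) by auto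
      then have d: "x \<noteq> y" "y \<noteq> z" "x \<noteq> z" using h by blast+
      consider "{x, z} = {u, v}" | "{x, y} = {u, v}" | "{y, z} = {u, v}"
        | "{x, z} \<noteq> {u, v}" "{x, y} \<noteq> {u, v}" "{y, z} \<noteq> {u, v}" by blast
      then show "\<psi> x z = (\<psi> x y \<noteq> \<psi> y z)"
      proof cases
        case 1
        then have "(x, y) \<in> edges G" "(y, z) \<in> edges G" using h d unfolding E' by (metis doubleton_eq_iff)+
        then show ?thesis using eu[OF 1] by blast
      next
        case 2
        then have "(x, z) \<in> edges G" "(z, y) \<in> edges G"
          using h d edgesD(3)[OF G(1)] unfolding E' by (metis doubleton_eq_iff)+
        then show ?thesis using eu[OF 2] sym[of z y] by blast
      next
        case 3
        then have "(y, x) \<in> edges G" "(x, z) \<in> edges G"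
          using h d edgesD(3)[OF G(1)] unfolding E' by (metis doubleton_eq_iff)+
        then show ?thesis using eu[OF 3] sym[of y x] by blast
      next
        case 4
        then show ?thesis using h cocycleD(2)[OF \<phi>, of x y z] unfolding E' by (simp add: \<psi>_def)
      qed
    qed
    from coh_trivialD[OF triv this]
    obtain f :: "'a \<Rightarrow> bool" where f: "\<forall>x y. (x, y) \<in> edges ?G' \<longrightarrow> \<psi> x y = (f x \<noteq> f y)" by (rule exE)
    note f = f[rule_format]
    have "\<phi> x y = (f x \<noteq> f y)" if xy: "(x, y) \<in> edges G" for x y
    proof -
      have "{x, y} \<noteq> {u, v}" using xy G(5) edgesD(3)[OF G(1) xy] by (auto simp: doubleton_eq_iff)
      then show ?thesis using f[of x y] xy by (simp add: \<psi>_def)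
    qed
    then show ?thesis unfolding coboundary_def by blast
  qed
  with conn show ?thesis by (simp add: coh_trivial_def)
qed

text \<open>\<open>convert\<close> infers contractibility of the source of a transformation from
  that of its target; the companion statement about transformations therefore pulls triviality back
  from \<open>G'\<close> to \<open>G\<close>.\<close>

lemma contractible_coh_trivial:
  shows "contractible_graph G \<Longrightarrow> coh_trivial G"
    and "contractible_transformation G G' \<Longrightarrow> coh_trivial G' \<Longrightarrow> coh_trivial G"
proof (induction rule: contractible_graph_contractible_transformation.inducts)
  case (one_point x)
  show ?case by (auto simp: coh_trivial_def conn_on_def coboundary_def)
next
  case (point_deletion G v)
  have "conn_on (edges (rim G v)) (pts (rim G v))"
    using point_deletion.IH unfolding coh_trivial_def by (rule conjunct1)
  then show ?case by (rule coh_trivial_point_deletion[OF point_deletion.hyps(1,2) _ point_deletion.prems])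
next
  case (point_gluing G v A)
  show ?case by (rule coh_trivial_point_gluing[OF point_gluing.hyps(1-3) point_gluing.IH point_gluing.prems])
next
  case (edge_deletion G u v)
  show ?case by (rule coh_trivial_edge_deletion[OF edge_deletion.hyps(1,2) edge_deletion.IH edge_deletion.prems])
next
  case (edge_addition G u v)
  show ?case by (rule coh_trivial_edge_addition[OF edge_addition.hyps(1-5) edge_addition.IH edge_addition.prems])
qed assumption+

subsection \<open>Contractible cones and paths\<close>

lemma contractible_point_deletion:
  assumes "digital_space G" "v \<in> pts G" "contractible_graph (rim G v)" "contractible_graph (delete_point G v)"
  shows "contractible_graph G"
  using assms by (meson convert point_deletion)

lemma contractible_singleton:
  assumes "digital_space G" "x \<in> pts G"
  shows "contractible_graph (induced G {x})"
proof -
  have "induced G {x} = \<lparr>pts = {x}, edges = {}\<rparr>"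
    using assms edgesD(4)[OF assms(1)] by (auto simp: induced_def)
  then show ?thesis using one_point by metis
qed

text \<open>Every point other than the apex can be deleted, because its rim is a smaller cone with
  the same apex.\<close>

lemma contractible_cone:
  assumes G: "digital_space G" and "A \<subseteq> pts G" "finite A" "v \<in> A"
    and "\<And>x. x \<in> A \<Longrightarrow> x \<noteq> v \<Longrightarrow> (v, x) \<in> edges G"
  shows "contractible_graph (induced G A)"
  using assms(2-)
proof (induction "card A" arbitrary: A rule: less_induct)
  case less
  show ?case
  proof (cases "A = {v}")
    case True
    then show ?thesis using contractible_singleton[OF G] less by auto
  next
    case False
    then obtain u where u: "u \<in> A" "u \<noteq> v" using less.prems by blast
    let ?B = "A \<inter> nbrs G u"
    have u': "u \<notin> ?B" using edgesD(4)[OF G] by (auto simp: nbrs_def)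
    have 1: "rim (induced G A) u = induced G ?B"
      using u by (auto simp: rim_def induced_def nbrs_def)
    have "A \<inter> (pts (induced G A) - {u}) = A - {u}" using less.prems(1) by auto
    then have 2: "delete_point (induced G A) u = induced G (A - {u})"
      by (simp only: delete_point_def induced_induced)
    show ?thesis
    proof (rule contractible_point_deletion[where v = u])
      show "digital_space (induced G A)" using digital_space_induced[OF G] .
      show "u \<in> pts (induced G A)" using u less.prems by auto
      have "card ?B < card A" using u u' less.prems by (intro psubset_card_mono) auto
      moreover have "v \<in> ?B" using less.prems u edgesD(3)[OF G] by (auto simp: nbrs_def)
      ultimately show "contractible_graph (rim (induced G A) u)"
        unfolding 1 using less.prems by (intro less.hyps) auto
      have "card (A - {u}) < card A" using u less.prems by (intro psubset_card_mono) auto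
      then show "contractible_graph (delete_point (induced G A) u)"
        unfolding 2 using less.prems u by (intro less.hyps) auto
    qed
  qed
qed

text \<open>The last point has a one-point rim, so the path shrinks from that end.\<close>

lemma contractible_path:
  assumes G: "digital_space G" and "i \<le> l" "c ` {i..l} \<subseteq> pts G" "inj_on c {i..l}"
    and "\<And>s t. s \<in> {i..l} \<Longrightarrow> t \<in> {i..l} \<Longrightarrow> (c s, c t) \<in> edges G \<longleftrightarrow> t = Suc s \<or> s = Suc t"
  shows "contractible_graph (induced G (c ` {i..l}))"
  using assms(2-)
proof (induction l rule: dec_induct)
  case base
  then show ?case using contractible_singleton[OF G] by simp
next
  case (step l)
  let ?G = "induced G (c ` {i..Suc l})"
  have eq: "{i..Suc l} = insert (Suc l) {i..l}" using step by auto
  have adj: "(c (Suc l), c t) \<in> edges G \<longleftrightarrow> t = l" if "t \<in> {i..Suc l}" for t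
    using step.prems(3)[of "Suc l" t] that step.hyps by auto
  have nb: "nbrs ?G (c (Suc l)) = {c l}"
    using adj step.hyps by (auto simp: nbrs_def)
  have sub: "c ` {i..l} \<subseteq> pts G" "c l \<in> pts G" using step.prems(1) step.hyps by (auto simp: eq)
  have ni: "c (Suc l) \<notin> c ` {i..l}"
    using step.prems(2) step.hyps unfolding eq by auto
  show ?case
  proof (rule contractible_point_deletion[where v = "c (Suc l)"])
    show "digital_space ?G" using digital_space_induced[OF G] .
    show "c (Suc l) \<in> pts ?G" using step.prems(1) step.hyps by auto
    have "rim ?G (c (Suc l)) = induced G {c l}"
      unfolding rim_def nb induced_induced using step.hyps
      by (simp add: Int_absorb1 eq)
    then show "contractible_graph (rim ?G (c (Suc l)))"
      using contractible_singleton[OF G sub(2)] by simp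
    have "delete_point ?G (c (Suc l)) = induced G (c ` {i..l})"
      unfolding delete_point_def induced_induced
      by (rule arg_cong[where f = "induced G"]) (use step.prems(1) ni sub in \<open>auto simp: eq\<close>)
    moreover have "inj_on c {i..l}" using step.prems(2) by (rule inj_on_subset) auto
    ultimately show "contractible_graph (delete_point ?G (c (Suc l)))"
      using step.IH[OF sub(1)] step.prems(3) by simp
  qed
qed

subsection \<open>Extension of cocycles\<close>

lemma odd_card_sym_diff:
  assumes "finite A" "finite B"
  shows "odd (card (sym_diff A B)) \<longleftrightarrow> odd (card A) \<noteq> odd (card B)"
proof -
  have "card A = card (A - B) + card (A \<inter> B)" "card B = card (B - A) + card (A \<inter> B)"
    using assms by (metis Int_Diff_disjoint Un_Diff_Int card_Un_disjoint finite_Diff finite_Int inf_commute)+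
  moreover have "card (sym_diff A B) = card (A - B) + card (B - A)"
    using assms by (intro card_Un_disjoint) auto
  ultimately show ?thesis by auto
qed

locale finite_surface =
  fixes H :: "'a::infinite graph"
  assumes space: "digital_space H"
    and fin: "finite (pts H)"
    and conn: "conn_on (edges H) (pts H)"
    and link: "v \<in> pts H \<Longrightarrow> digital_sphere 1 (rim H v)"
begin

lemmas edgeD = edgesD[OF space]

lemma nbrs_iff: "y \<in> nbrs H x \<longleftrightarrow> (x, y) \<in> edges H"
  by (simp add: nbrs_def)

lemma nbrs_neq: "y \<in> nbrs H x \<Longrightarrow> y \<noteq> x"
  using edgeD(4) by (metis nbrs_iff)

lemma nbrs_sym: "y \<in> nbrs H x \<Longrightarrow> x \<in> nbrs H y"
  using edgeD(3) by (simp add: nbrs_iff)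

lemma pts_rim: "pts (rim H v) = nbrs H v"
  using nbrs_subset[OF space, of v] by (simp add: rim_def Int_absorb2)

lemma link_conn:
  assumes "v \<in> pts H"
  shows "conn_on (edges H) (nbrs H v)"
proof -
  have "conn_on (edges (rim H v)) (pts (rim H v))"
    using sphere1D(1,3)[OF link[OF assms]] connected_graph_iff by blast
  then show ?thesis unfolding pts_rim by (simp add: rim_def conn_on_restrict)
qed

lemma link_cycle:
  assumes "v \<in> pts H" "x0 \<in> nbrs H v"
  obtains n c where "cycle_enum (rim H v) n c" "c 0 = x0"
  using sphere1_cycle_enum[OF link[OF assms(1)]] assms(2) pts_rim by metis

lemma link_cycleD:
  assumes "cycle_enum (rim H v) n c"
  shows "n \<ge> 4" "nbrs H v = c ` {..<n}" "inj_on c {..<n}"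
    "i < n \<Longrightarrow> j < n \<Longrightarrow> (c i, c j) \<in> edges H \<longleftrightarrow>
        j = Suc i \<or> i = Suc j \<or> (i = 0 \<and> j = n - 1) \<or> (j = 0 \<and> i = n - 1)"
proof -
  show "n \<ge> 4" and N: "nbrs H v = c ` {..<n}" and "inj_on c {..<n}"
    using assms unfolding cycle_enum_def pts_rim by blast+
  assume ij: "i < n" "j < n"
  then have "(c i, c j) \<in> edges (rim H v) \<longleftrightarrow> (c i, c j) \<in> edges H"
    unfolding rim_def N by simp
  then show "(c i, c j) \<in> edges H \<longleftrightarrow>
        j = Suc i \<or> i = Suc j \<or> (i = 0 \<and> j = n - 1) \<or> (j = 0 \<and> i = n - 1)"
    using assms ij unfolding cycle_enum_def by blast
qed

text \<open>\<open>y\<close> is a point of the cycle \<open>rim H x\<close>, and its two neighbours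
  on that cycle are the common ones. Every edge thus lies in exactly two triangles, the local form
  of being a closed surface.\<close>

lemma common_nbrs:
  assumes "(x, y) \<in> edges H"
  obtains p q where "p \<noteq> q" "nbrs H x \<inter> nbrs H y = {p, q}" "(p, q) \<notin> edges H"
proof -
  have "y \<in> pts (rim H x)" using assms by (simp add: pts_rim nbrs_iff)
  then obtain p q where pq: "p \<noteq> q" "nbrs (rim H x) y = {p, q}" "(p, q) \<notin> edges (rim H x)"
    using sphere1_nbrs[OF link] edgeD(1)[OF assms] by metis
  have N: "nbrs (rim H x) y = nbrs H x \<inter> nbrs H y"
    using assms by (auto simp: rim_def nbrs_def)
  have "(p, q) \<notin> edges H" using pq(2,3) unfolding N by (auto simp: rim_def)
  then show ?thesis using that pq N by simp
qed

section \<open>Mod-two coboundaries of sets of edges\<close>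

definition edge_sets :: "'a set set" where
  "edge_sets = {{x, y} |x y. (x, y) \<in> edges H}"

definition triangles :: "'a set set" where
  "triangles = {{x, y, z} |x y z. (x, y) \<in> edges H \<and> (y, z) \<in> edges H \<and> (x, z) \<in> edges H}"

text \<open>The simplicial coboundary from degree one to degree two: a cochain is identified with
  the set of simplices on which it is 1, and symmetric difference is addition.\<close>

definition cobd :: "'a set set \<Rightarrow> 'a set set" where
  "cobd F = {t \<in> triangles. odd (card {e \<in> F. e \<subseteq> t})}"

lemma finite_edge_sets: "finite edge_sets"
  by (rule finite_subset[of _ "Pow (pts H)"]) (use fin edgeD(1,2) in \<open>auto simp: edge_sets_def\<close>)

lemma finite_triangles: "finite triangles"
  by (rule finite_subset[of _ "Pow (pts H)"]) (use fin edgeD(1,2) in \<open>auto simp: triangles_def\<close>)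

lemma edge_in_triangle:
  assumes "e \<in> edge_sets" "e \<subseteq> {x, y, z}"
  shows "e = {x, y} \<or> e = {y, z} \<or> e = {x, z}"
proof -
  obtain a b where e: "e = {a, b}" "(a, b) \<in> edges H" using assms(1) unfolding edge_sets_def by blast
  have "a \<noteq> b" using edgeD(4)[OF e(2)] .
  moreover have "a = x \<or> a = y \<or> a = z" "b = x \<or> b = y \<or> b = z" using assms(2) e(1) by blast+
  ultimately show ?thesis unfolding e(1) by (elim disjE) (simp_all add: insert_commute)
qed

lemma cobd_triangle:
  assumes F: "F \<subseteq> edge_sets" and t: "(x, y) \<in> edges H" "(y, z) \<in> edges H" "(x, z) \<in> edges H"
  shows "{x, y, z} \<in> cobd F \<longleftrightarrow> ({x, y} \<in> F) \<noteq> (({y, z} \<in> F) \<noteq> ({x, z} \<in> F))"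
proof -
  have d: "x \<noteq> y" "y \<noteq> z" "x \<noteq> z" using t edgeD(4) by blast+
  then have d': "{x, y} \<noteq> {y, z}" "{x, y} \<noteq> {x, z}" "{y, z} \<noteq> {x, z}" by (auto simp: doubleton_eq_iff)
  have "{e \<in> F. e \<subseteq> {x, y, z}} = F \<inter> {{x, y}, {y, z}, {x, z}}"
    using F edge_in_triangle[of _ x y z] by blast
  moreover have "odd (card (F \<inter> {{x, y}, {y, z}, {x, z}})) \<longleftrightarrow> ({x, y} \<in> F) \<noteq> (({y, z} \<in> F) \<noteq> ({x, z} \<in> F))"
    using d' by (cases "{x, y} \<in> F"; cases "{y, z} \<in> F"; cases "{x, z} \<in> F") (simp_all add: Int_insert_right)
  moreover have "{x, y, z} \<in> triangles" using t by (auto simp: triangles_def)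
  ultimately show ?thesis by (simp add: cobd_def)
qed

lemma cobd_sym_diff:
  assumes "finite F" "finite F'"
  shows "cobd (sym_diff F F') = sym_diff (cobd F) (cobd F')"
proof -
  have "odd (card {e \<in> sym_diff F F'. e \<subseteq> t}) \<longleftrightarrow>
      odd (card {e \<in> F. e \<subseteq> t}) \<noteq> odd (card {e \<in> F'. e \<subseteq> t})" for t
  proof -
    have "{e \<in> sym_diff F F'. e \<subseteq> t} = sym_diff {e \<in> F. e \<subseteq> t} {e \<in> F'. e \<subseteq> t}" by blast
    then show ?thesis using odd_card_sym_diff[of "{e \<in> F. e \<subseteq> t}" "{e \<in> F'. e \<subseteq> t}"] assms by simp
  qed
  then show ?thesis unfolding cobd_def by blast
qed

lemma triangle_at:
  assumes "t \<in> triangles" "k \<in> t"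
  obtains a p where "t = {k, a, p}" "(k, a) \<in> edges H" "p \<in> nbrs H k \<inter> nbrs H a"
proof -
  obtain x y z where t: "t = {x, y, z}" "(x, y) \<in> edges H" "(y, z) \<in> edges H" "(x, z) \<in> edges H"
    using assms(1) by (auto simp: triangles_def)
  have s: "(y, x) \<in> edges H" "(z, y) \<in> edges H" "(z, x) \<in> edges H" using t(2-4)[THEN edgeD(3)] by blast+
  consider "k = x" | "k = y" | "k = z" using assms(2) t by blast
  then show ?thesis
  proof cases
    case 1
    have "t = {k, y, z}" "(k, y) \<in> edges H" "z \<in> nbrs H k \<inter> nbrs H y"
      using t s 1 unfolding nbrs_def by blast+
    then show ?thesis by (rule that)
  next
    case 2
    have "t = {k, x, z}" "(k, x) \<in> edges H" "z \<in> nbrs H k \<inter> nbrs H x"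
      using t s 2 unfolding nbrs_def by blast+
    then show ?thesis by (rule that)
  next
    case 3
    have "t = {k, x, y}" "(k, x) \<in> edges H" "y \<in> nbrs H k \<inter> nbrs H x"
      using t s 3 unfolding nbrs_def by blast+
    then show ?thesis by (rule that)
  qed
qed

lemma triangles_on_edge:
  assumes "(x, y) \<in> edges H" "nbrs H x \<inter> nbrs H y = {p, q}"
  shows "{t \<in> triangles. {x, y} \<subseteq> t} = {{x, y, p}, {x, y, q}}"
proof -
  have xy: "x \<noteq> y" using edgeD(4) assms by blast
  have pq: "(x, r) \<in> edges H \<and> (y, r) \<in> edges H \<longleftrightarrow> r = p \<or> r = q" for r
    using assms(2) unfolding nbrs_def by blast
  have "t \<in> {{x, y, p}, {x, y, q}}" if t: "t \<in> triangles" "{x, y} \<subseteq> t" for t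
  proof -
    obtain b c where bc: "t = {x, b, c}" "(x, b) \<in> edges H" "c \<in> nbrs H x \<inter> nbrs H b"
      using triangle_at[OF t(1), of x] t(2) by blast
    have "y = b \<or> y = c" using t(2) xy bc(1) by blast
    then have "\<exists>r. t = {x, y, r} \<and> (x, r) \<in> edges H \<and> (y, r) \<in> edges H"
    proof
      assume "y = b" then show ?thesis using bc nbrs_iff by blast
    next
      assume "y = c" then show ?thesis using bc nbrs_iff edgeD(3) by (metis IntD1 IntD2 insert_commute)
    qed
    then obtain r where "t = {x, y, r}" "r = p \<or> r = q" using pq by blast
    then show ?thesis by blast
  qed
  moreover have "{x, y, p} \<in> triangles" "{x, y, q} \<in> triangles"
    using pq assms(1) unfolding triangles_def by blast+
  ultimately show ?thesis by blast
qed

lemma cobd_edge: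
  assumes "(x, y) \<in> edges H" "nbrs H x \<inter> nbrs H y = {p, q}"
  shows "cobd {{x, y}} = {{x, y, p}, {x, y, q}}"
proof -
  have "{e \<in> {{x, y}}. e \<subseteq> t} = (if {x, y} \<subseteq> t then {{x, y}} else {})" for t by auto
  then have "cobd {{x, y}} = {t \<in> triangles. {x, y} \<subseteq> t}" by (auto simp: cobd_def)
  then show ?thesis using triangles_on_edge[OF assms] by simp
qed

text \<open>Double counting: every edge lies in exactly two triangles.\<close>

lemma even_card_cobd:
  assumes "F \<subseteq> edge_sets"
  shows "even (card (cobd F))"
proof -
  have "card {t \<in> triangles. e \<subseteq> t} = 2" if "e \<in> F" for e
  proof -
    obtain x y where xy: "e = {x, y}" "(x, y) \<in> edges H" using \<open>e \<in> F\<close> assms by (auto simp: edge_sets_def)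
    obtain p q where pq: "p \<noteq> q" "nbrs H x \<inter> nbrs H y = {p, q}" using common_nbrs[OF xy(2)] by metis
    then have "p \<noteq> x" "p \<noteq> y" "q \<noteq> x" "q \<noteq> y" using nbrs_neq by blast+
    then have "{x, y, p} \<noteq> {x, y, q}" using pq(1) by auto
    then show ?thesis using triangles_on_edge[OF xy(2) pq(2)] xy(1) by simp
  qed
  then have "(\<Sum>t\<in>triangles. card {e \<in> F. e \<subseteq> t}) = 2 * card F"
    by (intro sum_multicount[OF finite_triangles finite_subset[OF assms finite_edge_sets]]) blast
  then have "even (\<Sum>t\<in>triangles. card {e \<in> F. e \<subseteq> t})" by simp
  then show ?thesis using even_sum_iff[OF finite_triangles, of "\<lambda>t. card {e \<in> F. e \<subseteq> t}"] unfolding cobd_def by simp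
qed

text \<open>The witness \<open>A\<close> arises from a chain of triangles, consecutive ones sharing
  an edge that meets \<open>K\<close>: the coboundary of a single edge consists of the two triangles
  on it, so the sum over the chain telescopes.\<close>

definition dual_joined :: "'a set \<Rightarrow> 'a set \<Rightarrow> 'a set \<Rightarrow> bool" where
  "dual_joined K t t' \<longleftrightarrow>
     (\<exists>A \<subseteq> edge_sets. (\<forall>e\<in>A. e \<inter> K \<noteq> {}) \<and> cobd A = sym_diff {t} {t'})"

lemma dual_joined_refl: "dual_joined K t t"
  unfolding dual_joined_def by (rule exI[of _ "{}"]) (simp add: cobd_def)

lemma dual_joined_trans:
  assumes "dual_joined K t t'" "dual_joined K t' t''"
  shows "dual_joined K t t''"
proof -
  obtain A where A: "A \<subseteq> edge_sets" "\<forall>e\<in>A. e \<inter> K \<noteq> {}" "cobd A = sym_diff {t} {t'}"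
    using assms(1) unfolding dual_joined_def by (elim exE conjE)
  obtain B where B: "B \<subseteq> edge_sets" "\<forall>e\<in>B. e \<inter> K \<noteq> {}" "cobd B = sym_diff {t'} {t''}"
    using assms(2) unfolding dual_joined_def by (elim exE conjE)
  have "cobd (sym_diff A B) = sym_diff (cobd A) (cobd B)"
    by (rule cobd_sym_diff[OF finite_subset[OF A(1) finite_edge_sets] finite_subset[OF B(1) finite_edge_sets]])
  also have "\<dots> = sym_diff {t} {t''}" unfolding A(3) B(3) by auto
  finally have "cobd (sym_diff A B) = sym_diff {t} {t''}" .
  moreover have "sym_diff A B \<subseteq> edge_sets" using A(1) B(1) by blast
  moreover have "\<forall>e\<in>sym_diff A B. e \<inter> K \<noteq> {}" using A(2) B(2) by blast
  ultimately show ?thesis unfolding dual_joined_def by (intro exI[of _ "sym_diff A B"] conjI)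
qed

lemma dual_joined_on_edge:
  assumes k: "k \<in> K" and "(k, a) \<in> edges H"
    and "p \<in> nbrs H k \<inter> nbrs H a" "q \<in> nbrs H k \<inter> nbrs H a"
  shows "dual_joined K {k, a, p} {k, a, q}"
proof (cases "p = q")
  case True then show ?thesis using dual_joined_refl by simp
next
  case False
  obtain p' q' where N': "nbrs H k \<inter> nbrs H a = {p', q'}" using common_nbrs[OF assms(2)] by metis
  have "{p', q'} = {p, q}" using assms(3,4) False unfolding N' by blast
  with N' have N: "nbrs H k \<inter> nbrs H a = {p, q}" by simp
  have "p \<noteq> k" "p \<noteq> a" "q \<noteq> k" "q \<noteq> a" using assms nbrs_neq by blast+
  then have "{k, a, p} \<noteq> {k, a, q}" using False by blast
  then have "sym_diff {{k, a, p}} {{k, a, q}} = {{k, a, p}, {k, a, q}}" by (simp add: insert_Diff_if insert_commute)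
  then have "cobd {{k, a}} = sym_diff {{k, a, p}} {{k, a, q}}"
    using cobd_edge[OF assms(2) N] by simp
  then show ?thesis unfolding dual_joined_def
    using assms(1,2) by (intro exI[of _ "{{k, a}}"] conjI) (simp_all, unfold edge_sets_def, blast)
qed

text \<open>The triangles at \<open>k\<close> correspond to the edges of its link; going around the
  connected link crosses only edges at \<open>k\<close>, and these meet \<open>K\<close>.\<close>

lemma dual_joined_at_point:
  assumes k: "k \<in> K" and t: "t \<in> triangles" "k \<in> t" and t': "t' \<in> triangles" "k \<in> t'"
  shows "dual_joined K t t'"
proof -
  obtain a p where a: "t = {k, a, p}" "(k, a) \<in> edges H" "p \<in> nbrs H k \<inter> nbrs H a"
    using triangle_at[OF t] by metis
  obtain b q where b: "t' = {k, b, q}" "(k, b) \<in> edges H" "q \<in> nbrs H k \<inter> nbrs H b"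
    using triangle_at[OF t'] by metis
  have kH: "k \<in> pts H" using edgeD(1) a(2) by blast
  let ?P = "\<lambda>c. \<forall>r\<in>nbrs H k \<inter> nbrs H c. dual_joined K t {k, c, r}"
  have a': "a \<in> nbrs H k" and b': "b \<in> nbrs H k" using a(2) b(2) nbrs_iff by blast+
  have Pa: "?P a" using dual_joined_on_edge[OF k a(2,3)] a(1) by blast
  have "?P b"
    using b'
  proof (rule conn_on_induct[where P = "?P", OF link_conn[OF kH] a' Pa, rotated])
    fix c d assume cd: "c \<in> nbrs H k" "d \<in> nbrs H k" "(c, d) \<in> edges H" "?P c"
    then have dk: "(k, d) \<in> edges H" "c \<in> nbrs H k \<inter> nbrs H d" "d \<in> nbrs H k \<inter> nbrs H c"
      using nbrs_sym by (simp_all add: nbrs_iff)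
    have "dual_joined K t {k, c, d}" using cd(4) dk(3) by blast
    then have "dual_joined K t {k, d, c}" by (simp add: insert_commute)
    then show "?P d" using dual_joined_on_edge[OF k dk(1,2)] dual_joined_trans by blast
  qed
  then show ?thesis using b by blast
qed

text \<open>Two adjacent points of \<open>K\<close> lie in a common triangle, through which a chain
  passes from the star of one point to the star of the other.\<close>

lemma dual_joined_conn:
  assumes K: "conn_on (edges H) K"
    and t: "t \<in> triangles" "t \<inter> K \<noteq> {}" and t': "t' \<in> triangles" "t' \<inter> K \<noteq> {}"
  shows "dual_joined K t t'"
proof -
  obtain k k' where k: "k \<in> t" "k \<in> K" and k': "k' \<in> t'" "k' \<in> K" using t t' by blast
  let ?P = "\<lambda>x. \<forall>s\<in>triangles. x \<in> s \<longrightarrow> dual_joined K t s"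
  have Pk: "?P k" using dual_joined_at_point[OF k(2) t(1) k(1)] by blast
  have "?P k'"
    using k'(2)
  proof (rule conn_on_induct[where P = "?P", OF K k(2) Pk, rotated])
    fix x y assume xy: "x \<in> K" "y \<in> K" "(x, y) \<in> edges H" "?P x"
    obtain p where p: "p \<in> nbrs H x \<inter> nbrs H y" using common_nbrs[OF xy(3)] by blast
    have T: "{x, y, p} \<in> triangles" using p xy(3) unfolding triangles_def nbrs_def by blast
    with xy(4) have "dual_joined K t {x, y, p}" by blast
    moreover have "dual_joined K {x, y, p} s" if "s \<in> triangles" "y \<in> s" for s
      by (rule dual_joined_at_point[OF xy(2) T _ that]) simp
    ultimately show "?P y" using dual_joined_trans by blast
  qed
  then show ?thesis using k' t' by blast
qed

text \<open>Any two triangles that meet \<open>K\<close> cancel by adding a suitable coboundary, so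
  parity is the only obstruction, as for the top cohomology of a connected closed surface.\<close>

lemma even_is_cobd:
  assumes K: "conn_on (edges H) K"
    and B: "B \<subseteq> triangles" "\<forall>t\<in>B. t \<inter> K \<noteq> {}" "even (card B)"
  shows "\<exists>A \<subseteq> edge_sets. (\<forall>e\<in>A. e \<inter> K \<noteq> {}) \<and> cobd A = B"
  using B
proof (induction "card B" arbitrary: B rule: less_induct)
  case less
  have finB: "finite B" using less.prems finite_triangles finite_subset by blast
  show ?case
  proof (cases "B = {}")
    case True
    then show ?thesis by (intro exI[of _ "{}"]) (simp add: cobd_def)
  next
    case False
    then obtain t where t: "t \<in> B" by blast
    have "B \<noteq> {t}" using less.prems(3) by force
    then obtain t' where t': "t' \<in> B" "t' \<noteq> t" using t by blast
    let ?B = "B - {t, t'}"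
    have "card ?B = card B - card {t, t'}" using t t'(1) by (intro card_Diff_subset) simp_all
    then have c: "card ?B = card B - 2" using t'(2) by simp
    have "card B > 0" using t finB card_gt_0_iff by blast
    with c have "card ?B < card B" "even (card ?B)" using less.prems(3) by simp_all
    moreover have "?B \<subseteq> triangles" using less.prems(1) by blast
    moreover have "\<forall>t\<in>?B. t \<inter> K \<noteq> {}" using less.prems(2) by blast
    ultimately have "\<exists>A \<subseteq> edge_sets. (\<forall>e\<in>A. e \<inter> K \<noteq> {}) \<and> cobd A = ?B" by (intro less.hyps)
    then obtain A where A: "A \<subseteq> edge_sets" "\<forall>e\<in>A. e \<inter> K \<noteq> {}" "cobd A = ?B"
      by (elim exE conjE)
    have "dual_joined K t t'"
      using dual_joined_conn[OF K subsetD[OF less.prems(1) t] bspec[OF less.prems(2) t]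
          subsetD[OF less.prems(1) t'(1)] bspec[OF less.prems(2) t'(1)]] .
    then obtain A' where A': "A' \<subseteq> edge_sets" "\<forall>e\<in>A'. e \<inter> K \<noteq> {}" "cobd A' = sym_diff {t} {t'}"
      unfolding dual_joined_def by (elim exE conjE)
    have "cobd (sym_diff A A') = sym_diff (cobd A) (cobd A')"
      by (rule cobd_sym_diff[OF finite_subset[OF A(1) finite_edge_sets] finite_subset[OF A'(1) finite_edge_sets]])
    also have "\<dots> = B" unfolding A(3) A'(3) using t t' by auto
    finally have "cobd (sym_diff A A') = B" .
    moreover have "sym_diff A A' \<subseteq> edge_sets" using A(1) A'(1) by blast
    moreover have "\<forall>e\<in>sym_diff A A'. e \<inter> K \<noteq> {}" using A(2) A'(2) by blast
    ultimately show ?thesis by (intro exI[of _ "sym_diff A A'"] conjI)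
  qed
qed

text \<open>Consider a closed walk from \<open>u\<close> to \<open>g\<close>, through
  \<open>U\<close> to \<open>h\<close>, and back to \<open>u\<close>. Counting the edges between
  \<open>u\<close> and \<open>G\<close> gives it parity one, and this count can be corrected to a
  cocycle by edges meeting the connected region \<open>pts H - insert u U\<close>, which the walk
  does not touch.\<close>

lemma not_coh_trivial_if_separated:
  assumes U: "conn_on (edges H) U" "U \<subseteq> pts H" and u: "u \<in> pts H" "u \<notin> U"
    and K: "conn_on (edges H) (pts H - insert u U)"
    and G: "G \<subseteq> nbrs H u \<inter> U" "g \<in> G" "h \<in> nbrs H u \<inter> U" "h \<notin> G"
    and sep: "\<And>x y. x \<in> G \<Longrightarrow> y \<in> nbrs H u \<inter> U \<Longrightarrow> (x, y) \<in> edges H \<Longrightarrow> y \<in> G"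
  shows "\<not> coh_trivial H"
proof
  assume triv: "coh_trivial H"
  let ?K = "pts H - insert u U"
  \<comment> \<open>This cochain fails to be closed only on triangles that meet \<open>?K\<close>:
    if a triangle consists of \<open>u\<close> and two points of \<open>U\<close>, then by
    \<open>sep\<close> both of these or neither belong to \<open>G\<close>.\<close>
  define F0 where "F0 = (\<lambda>x. {u, x}) ` G"
  have F0: "F0 \<subseteq> edge_sets" using G(1) unfolding F0_def edge_sets_def nbrs_def by blast
  have inF0: "{x, y} \<in> F0 \<longleftrightarrow> x = u \<and> y \<in> G \<or> y = u \<and> x \<in> G" for x y
    unfolding F0_def by (auto simp: doubleton_eq_iff)
  have "t \<inter> ?K \<noteq> {}" if "t \<in> cobd F0" for t
  proof
    assume "t \<inter> ?K = {}"
    have "t \<in> triangles" using \<open>t \<in> cobd F0\<close> by (simp add: cobd_def)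
    then obtain x y z where t: "t = {x, y, z}" "(x, y) \<in> edges H" "(y, z) \<in> edges H" "(x, z) \<in> edges H"
      unfolding triangles_def by blast
    have sub: "x \<in> insert u U" "y \<in> insert u U" "z \<in> insert u U"
      using \<open>t \<inter> ?K = {}\<close> t(1) edgeD(1)[OF t(2)] edgeD(1)[OF t(3)] edgeD(2)[OF t(3)] by blast+
    note ne = edgeD(4)[OF t(2)] edgeD(4)[OF t(3)] edgeD(4)[OF t(4)]
    have GG: "a \<in> G \<longleftrightarrow> b \<in> G"
      if ab: "(u, a) \<in> edges H" "(u, b) \<in> edges H" "(a, b) \<in> edges H" "a \<in> insert u U" "b \<in> insert u U" for a b
    proof -
      have "a \<in> nbrs H u \<inter> U" "b \<in> nbrs H u \<inter> U"
        using ab edgeD(4)[OF ab(1)] edgeD(4)[OF ab(2)] by (simp_all add: nbrs_iff)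
      then show ?thesis using sep[of a b] sep[of b a] ab(3) edgeD(3)[OF ab(3)] by metis
    qed
    have uG: "u \<notin> G" using G(1) u(2) by blast
    have "{x, y, z} \<notin> cobd F0"
    proof (cases "u \<in> {x, y, z}")
      case False
      then have "x \<noteq> u" "y \<noteq> u" "z \<noteq> u" by blast+
      then show ?thesis unfolding cobd_triangle[OF F0 t(2-4)] inF0 by simp
    next
      case True
      then consider "x = u" | "y = u" | "z = u" by blast
      then show ?thesis
      proof cases
        case 1
        then have "y \<in> G \<longleftrightarrow> z \<in> G" using t(2-4) sub by (intro GG) simp_all
        with 1 ne uG show ?thesis unfolding cobd_triangle[OF F0 t(2-4)] inF0 by simp
      next
        case 2
        then have "x \<in> G \<longleftrightarrow> z \<in> G" using t(2-4) sub edgeD(3)[OF t(2)] by (intro GG) simp_all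
        with 2 ne uG show ?thesis unfolding cobd_triangle[OF F0 t(2-4)] inF0 by simp
      next
        case 3
        then have "x \<in> G \<longleftrightarrow> y \<in> G" using t(2-4) sub t(2-4)[THEN edgeD(3)] by (intro GG) simp_all
        with 3 ne uG show ?thesis unfolding cobd_triangle[OF F0 t(2-4)] inF0 by simp
      qed
    qed
    then show False using \<open>t \<in> cobd F0\<close> t(1) by simp
  qed
  then have "\<forall>t\<in>cobd F0. t \<inter> ?K \<noteq> {}" by (intro ballI)
  moreover have "cobd F0 \<subseteq> triangles" by (simp add: cobd_def)
  ultimately have "\<exists>A \<subseteq> edge_sets. (\<forall>e\<in>A. e \<inter> ?K \<noteq> {}) \<and> cobd A = cobd F0"
    by (intro even_is_cobd[OF K] even_card_cobd[OF F0])
  \<comment> \<open>The correction uses only edges that meet \<open>?K\<close>, so it changes no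
    value inside \<open>insert u U\<close>.\<close>
  then obtain A where A: "A \<subseteq> edge_sets" "\<forall>e\<in>A. e \<inter> ?K \<noteq> {}" "cobd A = cobd F0"
    by (elim exE conjE)
  define F where "F = sym_diff F0 A"
  have "cobd F = sym_diff (cobd F0) (cobd A)"
    unfolding F_def by (rule cobd_sym_diff[OF finite_subset[OF F0 finite_edge_sets] finite_subset[OF A(1) finite_edge_sets]])
  then have cF: "cobd F = {}" using A(3) by simp
  have F: "F \<subseteq> edge_sets" using F0 A(1) unfolding F_def by blast
  define \<phi> where "\<phi> x y \<longleftrightarrow> {x, y} \<in> F" for x y
  have "cocycle H \<phi>"
    unfolding cocycle_def
  proof (intro conjI allI impI)
    show "\<phi> x y = \<phi> y x" for x y by (simp add: \<phi>_def insert_commute)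
    fix x y z assume "(x, y) \<in> edges H" "(y, z) \<in> edges H" "(x, z) \<in> edges H"
    from cobd_triangle[OF F this] have "\<not> (\<phi> x y \<noteq> (\<phi> y z \<noteq> \<phi> x z))" by (simp add: cF \<phi>_def)
    then show "\<phi> x z = (\<phi> x y \<noteq> \<phi> y z)" by argo
  qed
  from coh_trivialD[OF triv this]
  obtain f :: "'a \<Rightarrow> bool" where f: "\<forall>x y. (x, y) \<in> edges H \<longrightarrow> \<phi> x y = (f x \<noteq> f y)" by (rule exE)
  have \<phi>U: "\<phi> x y \<longleftrightarrow> {x, y} \<in> F0" if "x \<in> insert u U" "y \<in> insert u U" for x y
  proof -
    have "{x, y} \<inter> ?K = {}" using that by blast
    then have "{x, y} \<notin> A" using A(2) by blast
    then show ?thesis by (simp add: \<phi>_def F_def)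
  qed
  have gU: "g \<in> U" "h \<in> U" "(u, g) \<in> edges H" "(u, h) \<in> edges H"
    using G(1-3) nbrs_iff by blast+
  \<comment> \<open>No edge inside \<open>U\<close> belongs to \<open>F\<close>, so a primitive is
    constant on the connected set \<open>U\<close>; but the edges from \<open>u\<close> to
    \<open>g\<close> and to \<open>h\<close> carry different values.\<close>
  have "f h = f g"
    using gU(2)
  proof (rule conn_on_induct[where P = "\<lambda>x. f x = f g", OF U(1) gU(1) refl, rotated])
    fix x y assume xy: "x \<in> U" "y \<in> U" "(x, y) \<in> edges H" "f x = f g"
    then have "x \<noteq> u" "y \<noteq> u" using u(2) by blast+
    then have "\<not> \<phi> x y" using \<phi>U[of x y] inF0 xy by simp
    then show "f y = f g" using f[rule_format, OF xy(3)] xy(4) by simp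
  qed
  moreover have "\<phi> u g" "\<not> \<phi> u h"
    using \<phi>U[of u g] \<phi>U[of u h] gU inF0 G(2,4) edgeD(4)[OF gU(4)] by simp_all
  ultimately show False using f[rule_format, OF gU(3)] f[rule_format, OF gU(4)] by simp
qed

subsection \<open>Surfaces with trivial cohomology are spheres\<close>

text \<open>A closed set of the remainder that meets the link of \<open>c\<close> contains the whole
  link, since the link is connected, and so stays closed when \<open>c\<close> is added back; one
  that misses the link is closed already.\<close>

lemma conn_delete_point:
  assumes c: "c \<in> pts H"
  shows "conn_on (edges H) (pts H - {c})"
  unfolding conn_on_def
proof (intro conjI allI impI)
  have L: "nbrs H c \<subseteq> pts H - {c}" using nbrs_subset[OF space] nbrs_neq by blast
  moreover have "nbrs H c \<noteq> {}" using link_conn[OF c] by (simp add: conn_on_def)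
  ultimately show "pts H - {c} \<noteq> {}" by blast
  fix X assume X: "X \<subseteq> pts H - {c}" "X \<noteq> {}" "\<forall>x\<in>X. \<forall>y\<in>pts H - {c}. (x, y) \<in> edges H \<longrightarrow> y \<in> X"
  show "X = pts H - {c}"
  proof (cases "nbrs H c \<inter> X = {}")
    case True
    have "X = pts H"
    proof (rule conn_onD[OF conn])
      fix x y assume xy: "x \<in> X" "y \<in> pts H" "(x, y) \<in> edges H"
      have "y \<noteq> c" using True xy(1) edgeD(3)[OF xy(3)] nbrs_iff by blast
      then show "y \<in> X" using X(3) xy by blast
    qed (use X in blast)+
    then show ?thesis using X(1) c by blast
  next
    case False
    have "nbrs H c \<inter> X = nbrs H c"
    proof (rule conn_onD[OF link_conn[OF c] _ False])
      fix x y assume xy: "x \<in> nbrs H c \<inter> X" "y \<in> nbrs H c" "(x, y) \<in> edges H"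
      then show "y \<in> nbrs H c \<inter> X" using X(3) L by blast
    qed blast
    have "insert c X = pts H"
    proof (rule conn_onD[OF conn])
      fix x y assume xy: "x \<in> insert c X" "y \<in> pts H" "(x, y) \<in> edges H"
      then show "y \<in> insert c X"
        using X(3) \<open>nbrs H c \<inter> X = nbrs H c\<close> nbrs_iff by blast
    qed (use X c in blast)+
    then show ?thesis using X(1) by blast
  qed
qed

text \<open>A piece cut off from \<open>K\<close> by a boundary point contains another boundary point, since no
  point disconnects the surface; a smallest piece therefore cannot exist.\<close>

lemma boundary_point_not_cut:
  assumes K: "conn_on (edges H) K" "K \<subseteq> pts H" "K \<noteq> pts H" and K2: "\<And>k. K \<noteq> {k}"
  shows "\<exists>u\<in>K. (\<exists>y\<in>pts H - K. (u, y) \<in> edges H) \<and> conn_on (edges H) (K - {u})"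
proof -
  define Bd where "Bd = {u \<in> K. \<exists>y\<in>pts H - K. (u, y) \<in> edges H}"
  define sep where "sep u X \<longleftrightarrow> X \<subseteq> K - {u} \<and> X \<noteq> {} \<and> X \<noteq> K - {u} \<and>
    (\<forall>x\<in>X. \<forall>y\<in>K - {u}. (x, y) \<in> edges H \<longrightarrow> y \<in> X)" for u X
  have "\<exists>u\<in>Bd. conn_on (edges H) (K - {u})"
  proof (rule ccontr)
    assume nex: "\<not> ?thesis"
    have cut: "\<exists>X. sep u X" if "u \<in> Bd" for u
    proof -
      have "\<not> conn_on (edges H) (K - {u})" using nex that by blast
      moreover have "K - {u} \<noteq> {}" using K2[of u] K(1) unfolding conn_on_def by blast
      ultimately show ?thesis unfolding conn_on_def sep_def by blast
    qed
    have sepC: "sep u (K - {u} - X)" if "sep u X" for u X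
      unfolding sep_def
    proof (intro conjI ballI impI)
      show "K - {u} - X \<subseteq> K - {u}" "K - {u} - X \<noteq> {}" "K - {u} - X \<noteq> K - {u}"
        using that unfolding sep_def by blast+
      fix x y assume xy: "x \<in> K - {u} - X" "y \<in> K - {u}" "(x, y) \<in> edges H"
      then show "y \<in> K - {u} - X" using that edgeD(3)[OF xy(3)] unfolding sep_def by blast
    qed
    have no: "\<not> sep u X" if "u \<in> Bd" for u X
      using that
    proof (induction "card X" arbitrary: u X rule: less_induct)
      case less
      show ?case
      proof
        assume s: "sep u X"
        \<comment> \<open>A piece \<open>X\<close> without boundary points would be closed in the
          connected set \<open>pts H - {u}\<close>, hence equal to it, and nothing of
          \<open>K - {u}\<close> would be left outside.\<close>
        have "\<exists>u'\<in>X. u' \<in> Bd"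
        proof (rule ccontr)
          assume no: "\<not> ?thesis"
          have "X = pts H - {u}"
          proof (rule conn_onD)
            show "conn_on (edges H) (pts H - {u})"
              using conn_delete_point less.prems K(2) unfolding Bd_def by blast
            show "X \<subseteq> pts H - {u}" "X \<noteq> {}" using s K(2) unfolding sep_def by blast+
            fix x y assume xy: "x \<in> X" "y \<in> pts H - {u}" "(x, y) \<in> edges H"
            have "x \<in> K" using s xy(1) unfolding sep_def by blast
            then have "y \<in> K" using no xy unfolding Bd_def by blast
            then show "y \<in> X" using s xy unfolding sep_def by blast
          qed
          then show False using s K(2) unfolding sep_def by blast
        qed
        then obtain u' where u': "u' \<in> X" "u' \<in> Bd" by blast
        obtain Y0 where Y0: "sep u' Y0" using cut[OF u'(2)] by blast
        \<comment> \<open>One of the two sides of the cut at \<open>u'\<close> avoids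
          \<open>u\<close>. It lies inside \<open>X\<close>, because its part outside
          \<open>X\<close> is closed in \<open>K\<close> and misses \<open>u\<close>; and it lacks
          \<open>u'\<close>, so it is strictly smaller.\<close>
        obtain Y where Y: "sep u' Y" "u \<notin> Y"
        proof (cases "u \<in> Y0")
          case True
          then show ?thesis using that[OF sepC[OF Y0]] by blast
        next
          case False
          then show ?thesis using that[OF Y0] by blast
        qed
        have "Y - X = {}"
        proof (rule ccontr)
          assume ne: "Y - X \<noteq> {}"
          have "Y - X = K"
          proof (rule conn_onD[OF K(1) _ ne])
            show "Y - X \<subseteq> K" using Y unfolding sep_def by blast
            fix w y assume wy: "w \<in> Y - X" "y \<in> K" "(w, y) \<in> edges H"
            have w: "w \<in> K - {u}" using wy(1) Y unfolding sep_def by blast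
            have "y \<notin> X" using s w wy(1) edgeD(3)[OF wy(3)] unfolding sep_def by blast
            moreover have "y \<in> Y" using Y(1) wy u'(1) \<open>y \<notin> X\<close> unfolding sep_def by blast
            ultimately show "y \<in> Y - X" by blast
          qed
          then show False using Y(2) less.prems unfolding Bd_def by blast
        qed
        then have "Y \<subset> X" using u'(1) Y(1) unfolding sep_def by blast
        moreover have "finite X"
          using s K(2) fin finite_subset unfolding sep_def by (metis Diff_subset)
        ultimately have "card Y < card X" by (rule psubset_card_mono[rotated])
        from less.hyps[OF this u'(2)] Y(1) show False by blast
      qed
    qed
    have "Bd \<noteq> {}"
    proof
      assume "Bd = {}"
      have "K = pts H"
        by (rule conn_onD[OF conn K(2)]) (use K(1) \<open>Bd = {}\<close> in \<open>unfold Bd_def conn_on_def, blast+\<close>)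
      with K(3) show False by blast
    qed
    then show False using cut no by blast
  qed
  then show ?thesis unfolding Bd_def by blast
qed

text \<open>Points of \<open>K\<close> are deleted one by one. If the link of a removable boundary point met \<open>K\<close> in
  more than one arc, the complement together with that point would carry a nontrivial cocycle.\<close>

lemma contractible_complement:
  assumes triv: "coh_trivial H"
    and K: "conn_on (edges H) K" "K \<subseteq> pts H" and U: "conn_on (edges H) (pts H - K)"
  shows "contractible_graph (induced H K)"
  using K U
proof (induction "card K" arbitrary: K rule: less_induct)
  case less
  note K = less.prems(1,2) and U = less.prems(3)
  let ?U = "pts H - K"
  show ?case
  proof (cases "\<exists>k. K = {k}")
    case True
    then show ?thesis using contractible_singleton[OF space] K(2) by blast
  next
    case False
    have "?U \<noteq> {}" using U unfolding conn_on_def by (rule conjunct1)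
    then have "K \<noteq> pts H" by blast
    from boundary_point_not_cut[OF K this] False
    obtain u where u1: "u \<in> K" "\<exists>y\<in>?U. (u, y) \<in> edges H" and conn': "conn_on (edges H) (K - {u})"
      by blast
    obtain y where "y \<in> ?U" "(u, y) \<in> edges H" using u1(2) by blast
    note u = u1(1) this
    have uH: "u \<in> pts H" using u K by blast
    have K': "pts H - (K - {u}) = insert u ?U" "pts H - insert u ?U = K - {u}" using uH K(2) by blast+
    have U': "conn_on (edges H) (insert u ?U)"
      by (rule conn_on_insert[OF U u(2) edgeD(3)[OF u(3)] u(3)])
    have NH: "nbrs H u \<subseteq> pts H" using nbrs_subset[OF space] .
    have "\<exists>k\<in>K. k \<in> nbrs H u"
    proof (rule ccontr)
      assume nk: "\<not> ?thesis"
      have "{u} = K"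
      proof (rule conn_onD[OF K(1)])
        fix x z assume "x \<in> {u}" "z \<in> K" "(x, z) \<in> edges H"
        then show "z \<in> {u}" using nk nbrs_iff by blast
      qed (use u(1) in simp_all)
      with False show False by blast
    qed
    then obtain k where k: "k \<in> K" "k \<in> nbrs H u" by blast
    have y: "y \<in> nbrs H u" using u(3) nbrs_iff by blast
    \<comment> \<open>Starting the enumeration at a point outside \<open>K\<close> keeps the indices
      of points in \<open>K\<close> from wrapping around, so an arc of the link is an interval of
      indices.\<close>
    obtain n c where c: "cycle_enum (rim H u) n c" and c0: "c 0 = y"
      using link_cycle[OF uH y] by metis
    note N = link_cycleD(2)[OF c] and inj = link_cycleD(3)[OF c] and E = link_cycleD(4)[OF c]
    define I where "I = {i. i < n \<and> c i \<in> K}"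
    have "finite I" unfolding I_def by simp
    moreover obtain m where "m < n" "k = c m" using k(2) unfolding N by blast
    then have "I \<noteq> {}" using k(1) unfolding I_def by blast
    ultimately have I: "finite I" "I \<noteq> {}" .
    define a where "a = Min I"
    define b where "b = Max I"
    have ab: "a \<in> I" "b \<in> I" "\<And>i. i \<in> I \<Longrightarrow> a \<le> i \<and> i \<le> b"
      using I unfolding a_def b_def by simp_all
    have a0: "a \<noteq> 0"
    proof
      assume "a = 0"
      then show False using ab(1) u(2) c0 unfolding I_def by simp
    qed
    have abn: "a \<le> b" "b < n" "c a \<in> K" "c b \<in> K" using ab(1,2) ab(3)[OF ab(1)] unfolding I_def by simp_all
    have arc: "c j \<in> K" if j: "a \<le> j" "j \<le> b" for j
    proof (rule ccontr)
      assume "c j \<notin> K"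
      then have j': "j < n" "c j \<in> ?U" using j abn N NH by auto
      \<comment> \<open>Within the link, these points are cut off from \<open>y\<close> by
        \<open>c a\<close> and \<open>c b\<close>, which lie in \<open>K\<close>. The complement of
        \<open>K\<close> takes the role of \<open>U\<close> in
        \<open>not_coh_trivial_if_separated\<close>, and \<open>K - {u}\<close> is the connected
        remainder.\<close>
      define G where "G = {c t |t. a < t \<and> t < b \<and> c t \<in> ?U}"
      have G_sub: "G \<subseteq> nbrs H u \<inter> ?U" using abn(2) unfolding G_def N by fastforce
      have "j \<noteq> a" "j \<noteq> b" using \<open>c j \<notin> K\<close> abn by auto
      then have jG: "c j \<in> G" using j j' unfolding G_def by fastforce
      have yG: "y \<notin> G"
      proof
        assume "y \<in> G"
        then obtain t where t: "c t = c 0" "a < t" "t < b" unfolding G_def c0 by blast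
        then show False using inj_onD[OF inj t(1)] abn(2) by simp
      qed
      have sep: "z \<in> G" if xz: "x \<in> G" "z \<in> nbrs H u \<inter> ?U" "(x, z) \<in> edges H" for x z
      proof -
        obtain t where t: "x = c t" "a < t" "t < b" using xz(1) unfolding G_def by blast
        obtain s where s: "z = c s" "s < n" using xz(2) N by auto
        have "s = Suc t \<or> t = Suc s" using xz(3) E[of t s] t s abn(2) by auto
        moreover have "s \<noteq> a" "s \<noteq> b" using xz(2) s(1) abn by auto
        ultimately have "a < s" "s < b" using t by linarith+
        then show ?thesis using s xz(2) unfolding G_def by blast
      qed
      have "u \<notin> ?U" "y \<in> nbrs H u \<inter> ?U" using u(1,2) y by simp_all
      from not_coh_trivial_if_separated[OF U Diff_subset uH this(1) _ G_sub jG this(2) yG sep]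
      show False using conn' triv by (simp only: K'(2))
    qed
    have KN: "K \<inter> nbrs H u = c ` {a..b}"
    proof
      show "c ` {a..b} \<subseteq> K \<inter> nbrs H u" using arc abn(2) unfolding N by auto
      show "K \<inter> nbrs H u \<subseteq> c ` {a..b}" using ab(3) unfolding N I_def by auto
    qed
    have "contractible_graph (induced H (c ` {a..b}))"
    proof (rule contractible_path[OF space abn(1)])
      show "c ` {a..b} \<subseteq> pts H" using KN NH by blast
      show "inj_on c {a..b}" by (rule inj_on_subset[OF inj]) (use abn(2) in auto)
      fix s t assume "s \<in> {a..b}" "t \<in> {a..b}"
      then show "(c s, c t) \<in> edges H \<longleftrightarrow> t = Suc s \<or> s = Suc t"
        using E[of s t] a0 abn(2) by auto
    qed
    moreover have "rim (induced H K) u = induced H (K \<inter> nbrs H u)"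
    proof -
      have "nbrs (induced H K) u = K \<inter> nbrs H u" using u(1) by (auto simp: nbrs_def)
      then show ?thesis by (simp add: rim_def induced_induced)
    qed
    ultimately have rim: "contractible_graph (rim (induced H K) u)" using KN by simp
    have "card (K - {u}) < card K"
      using u(1) finite_subset[OF K(2) fin] by (intro psubset_card_mono) auto
    then have "contractible_graph (induced H (K - {u}))"
      using less.hyps[OF _ conn'] K(2) U' unfolding K'(1) by blast
    moreover have "delete_point (induced H K) u = induced H (K - {u})"
    proof -
      have "K \<inter> (pts (induced H K) - {u}) = K - {u}" using K(2) by auto
      then show ?thesis by (simp only: delete_point_def induced_induced)
    qed
    moreover have "u \<in> pts (induced H K)" using u(1) uH by simp
    ultimately show ?thesis
      using contractible_point_deletion[OF digital_space_induced[OF space] _ rim] by simp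
  qed
qed

text \<open>The star of a point is a 2-disk, being the suspension of its link with one apex removed.\<close>

lemma star_disk:
  assumes v: "v \<in> pts H"
  shows "digital_disk 2 (induced H (insert v (nbrs H v))) (induced H (nbrs H v))"
proof -
  let ?L = "nbrs H v"
  let ?D = "induced H (insert v ?L)"
  have L: "?L \<subseteq> pts H" using nbrs_subset[OF space] .
  have vL: "v \<notin> ?L" using nbrs_neq by blast
  obtain w where w: "w \<notin> pts H" using ex_new_if_finite[OF infinite_UNIV fin] by blast
  have wv: "w \<noteq> v" "w \<notin> ?L" using w v L by blast+
  \<comment> \<open>\<open>w\<close> is the second apex of the suspension. Deleting it leaves the
    star of \<open>v\<close>, and its rim, the link of \<open>v\<close>, becomes the
    boundary.\<close>
  define M where "M = \<lparr>pts = insert w (insert v ?L),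
     edges = edges H \<inter> (insert v ?L \<times> insert v ?L) \<union> {w} \<times> ?L \<union> ?L \<times> {w}\<rparr>"
  have Mp: "pts M = insert w (insert v ?L)" by (simp add: M_def)
  have Me: "(x, y) \<in> edges M \<longleftrightarrow> (x, y) \<in> edges H \<and> x \<in> insert v ?L \<and> y \<in> insert v ?L \<or>
      x = w \<and> y \<in> ?L \<or> y = w \<and> x \<in> ?L" for x y
    unfolding M_def graph.select_convs Un_iff Int_iff mem_Times_iff fst_conv snd_conv singleton_iff by blast
  have wE: "(w, x) \<notin> edges H" "(x, w) \<notin> edges H" for x using w edgeD(1)[of w x] edgeD(2)[of x w] by blast+
  have finM: "finite (pts M)" using Mp finite_subset[OF L fin] by simp
  have spM: "digital_space M"
    unfolding digital_space_def
  proof (intro conjI)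
    show "countable (pts M)" using finM by (rule countable_finite)
    show "edges M \<subseteq> pts M \<times> pts M" unfolding M_def by auto
    show "sym (edges M)"
    proof (rule symI)
      fix x y assume "(x, y) \<in> edges M"
      then show "(y, x) \<in> edges M" unfolding Me using edgeD(3)[of x y] by blast
    qed
    show "irrefl (edges M)"
    proof (rule irreflI)
      show "(x, x) \<notin> edges M" for x unfolding Me using edgeD(4)[of x x] wv by blast
    qed
  qed
  have vM: "nbrs M v = ?L" unfolding nbrs_def[of M] Me using wv vL nbrs_iff nbrs_neq by blast
  have wM: "nbrs M w = ?L" unfolding nbrs_def[of M] Me using wv wE by blast
  have L_ne: "?L \<noteq> {}" using link_conn[OF v] by (simp add: conn_on_def)
  have rimL: "induced M ?L = rim H v"
    unfolding rim_def induced_def using L wv by (auto simp: Mp Me)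
  have rim_vw: "digital_sphere (2 - 1) (rim M v)" "digital_sphere (2 - 1) (rim M w)"
    unfolding rim_def[of M] vM wM rimL using link[OF v] by simp_all
  have rim_x: "digital_sphere (2 - 1) (rim M x)" if x: "x \<in> ?L" for x
  proof -
    have vx: "(v, x) \<in> edges H" using x nbrs_iff by blast
    obtain p q where pq: "p \<noteq> q" "?L \<inter> nbrs H x = {p, q}" "(p, q) \<notin> edges H"
      using common_nbrs[OF vx] by metis
    have pq': "p \<in> ?L" "q \<in> ?L" "(x, p) \<in> edges H" "(x, q) \<in> edges H" using pq(2) nbrs_iff by blast+
    have ne: "p \<noteq> v" "q \<noteq> v" "p \<noteq> w" "q \<noteq> w" using pq' vL wv by blast+
    have nx: "nbrs M x = {v, p, w, q}"
    proof -
      have "y \<in> nbrs M x \<longleftrightarrow> y = v \<or> y = w \<or> y \<in> ?L \<inter> nbrs H x" for y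
        unfolding nbrs_def[of M] mem_Collect_eq Me using x edgeD(3)[OF vx] wv wE nbrs_iff by blast
      then show ?thesis unfolding pq(2) by blast
    qed
    \<comment> \<open>The rim of a link point in the suspension is the suspension of its two
      neighbours \<open>p\<close> and \<open>q\<close> in the link, hence this 4-cycle.\<close>
    define c where "c = (\<lambda>i::nat. if i = 0 then v else if i = 1 then p else if i = 2 then w else q)"
    have e: "(v, p) \<in> edges M" "(p, w) \<in> edges M" "(w, q) \<in> edges M" "(q, v) \<in> edges M"
      "(p, v) \<in> edges M" "(w, p) \<in> edges M" "(q, w) \<in> edges M" "(v, q) \<in> edges M"
      using pq' nbrs_iff edgeD(3) unfolding Me by blast+
    have e': "(v, w) \<notin> edges M" "(w, v) \<notin> edges M" "(p, q) \<notin> edges M" "(q, p) \<notin> edges M"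
      using wE wv vL ne pq(3) edgeD(3) unfolding Me by blast+
    have e'': "(z, z) \<notin> edges M" for z using edgesD(4)[OF spM] by blast
    have i4: "i < 4 \<longleftrightarrow> i \<in> {0, 1, 2, 3}" for i :: nat by auto
    then have i4': "{..<4::nat} = {0, 1, 2, 3}" by blast
    have img: "c ` {0, 1, 2, 3} = {v, p, w, q}" by (auto simp: c_def)
    have tab: "\<forall>i\<in>{0, 1, 2, 3}. \<forall>j\<in>{0, 1, 2, 3}. (c i, c j) \<in> edges M \<longleftrightarrow>
        j = Suc i \<or> i = Suc j \<or> i = 0 \<and> j = 4 - 1 \<or> j = 0 \<and> i = 4 - 1"
      by (simp add: c_def e e' e'')
    have "cycle_enum (rim M x) 4 c"
      unfolding cycle_enum_def
    proof (intro conjI allI impI)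
      show "pts (rim M x) = c ` {..<4}"
        using nbrs_subset[OF spM, of x] unfolding i4' img rim_def pts_induced nx by blast
      show "inj_on c {..<4}"
        unfolding i4' inj_on_def using ne ne[symmetric] wv(1) wv(1)[symmetric] pq(1) pq(1)[symmetric]
        by (simp add: c_def)
      fix i j :: nat assume "i < 4" "j < 4"
      then have ij: "i \<in> {0, 1, 2, 3}" "j \<in> {0, 1, 2, 3}" using i4 by simp_all
      have "c i \<in> {v, p, w, q}" "c j \<in> {v, p, w, q}"
        using imageI[OF ij(1), of c] imageI[OF ij(2), of c] by (simp_all only: img)
      then have "(c i, c j) \<in> edges (rim M x) \<longleftrightarrow> (c i, c j) \<in> edges M"
        unfolding rim_def nx edges_induced by blast
      with bspec[OF bspec[OF tab ij(1)] ij(2)] show "(c i, c j) \<in> edges (rim M x) \<longleftrightarrow>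
          j = Suc i \<or> i = Suc j \<or> i = 0 \<and> j = 4 - 1 \<or> j = 0 \<and> i = 4 - 1"
        by (rule trans[rotated])
    qed simp
    moreover have "digital_space (rim M x)" unfolding rim_def by (rule digital_space_induced[OF spM])
    ultimately show ?thesis using cycle_enum_sphere1 by simp
  qed
  obtain l where l: "l \<in> ?L" using L_ne by blast
  have conn_star: "conn_on R (insert v ?L)" if R: "\<And>x. x \<in> ?L \<Longrightarrow> (v, x) \<in> R \<and> (x, v) \<in> R" for R
    unfolding conn_on_def
  proof (intro conjI allI impI)
    fix X assume X: "X \<subseteq> insert v ?L" "X \<noteq> {}" "\<forall>x\<in>X. \<forall>y\<in>insert v ?L. (x, y) \<in> R \<longrightarrow> y \<in> X"
    obtain x where x: "x \<in> X" using X(2) by blast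
    have "v \<in> X"
    proof (cases "x = v")
      case False
      then have "(x, v) \<in> R" using R x X(1) by blast
      then show ?thesis using X(3) x by blast
    qed (use x in simp)
    then show "X = insert v ?L" using X(1,3) R by blast
  qed simp
  have vx: "(v, x) \<in> edges H \<and> (x, v) \<in> edges H" if "x \<in> ?L" for x
    using that nbrs_iff edgeD(3) by blast
  have "conn_on (edges M) (pts M)"
    unfolding Mp
  proof (rule conn_on_insert)
    show "conn_on (edges M) (insert v ?L)" by (rule conn_star) (use vx Me in blast)
    show "l \<in> insert v ?L" "(l, w) \<in> edges M" "(w, l) \<in> edges M" using l Me by blast+
  qed
  then have cM: "closed_manifold 2 M"
    using rim_vw rim_x spM Mp connected_graph_iff[OF spM]
    by (intro closed_manifold) auto
  have Dsub: "insert v ?L \<subseteq> pts H" using v L by blast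
  have "manifold_with_boundary 2 ?D (induced ?D (id ` nbrs M w))"
  proof (rule manifold_with_boundary)
    show "digital_space ?D" using digital_space_induced[OF space] .
    show "connected_graph ?D"
      unfolding connected_induced_iff[OF space Dsub] by (rule conn_star) (rule vx)
    show "w \<in> pts M" by (simp add: Mp)
    show "graph_iso id (delete_point M w) ?D"
    proof -
      have p: "pts (delete_point M w) = insert v ?L" using wv by (auto simp: delete_point_def Mp)
      have q: "pts ?D = insert v ?L" using Dsub by auto
      have "(x, y) \<in> edges (delete_point M w) \<longleftrightarrow> (x, y) \<in> edges ?D"
        if "x \<in> insert v ?L" "y \<in> insert v ?L" for x y
      proof -
        have "x \<noteq> w" "y \<noteq> w" using that wv by blast+
        then show ?thesis
          using that unfolding delete_point_def edges_induced Int_iff mem_Times_iff fst_conv snd_conv Mp Me by blast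
      qed
      then show ?thesis unfolding graph_iso_def p q by (simp add: bij_betw_id)
    qed
  qed (simp_all add: cM)
  moreover have "induced ?D (id ` nbrs M w) = induced H ?L"
    unfolding wM image_id id_apply induced_induced by (rule arg_cong[where f = "induced H"]) blast
  moreover have "contractible_graph ?D"
    by (rule contractible_cone[OF space Dsub finite_subset[OF Dsub fin]]) (use vx in blast)+
  ultimately show ?thesis using disk_n[of 2] by simp
qed

lemma closed_manifold_H: "closed_manifold 2 H"
  by (rule closed_manifold) (use space conn connected_graph_iff[OF space] link in auto)

text \<open>\<open>H\<close> itself is the closed manifold whose point \<open>v\<close> is deleted.
  The one-point set \<open>{v}\<close> is the connected complement with which the successive
  deletions start.\<close>

lemma complement_disk:
  assumes triv: "coh_trivial H" and v: "v \<in> pts H"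
  shows "digital_disk 2 (induced H (pts H - {v})) (induced H (nbrs H v))"
proof -
  let ?D = "induced H (pts H - {v})"
  have Dc: "conn_on (edges H) (pts H - {v})" using conn_delete_point[OF v] .
  have "pts H - (pts H - {v}) = {v}" using v by blast
  moreover have "conn_on (edges H) {v}" unfolding conn_on_def by (simp add: subset_singleton_iff)
  ultimately have "contractible_graph ?D"
    using contractible_complement[OF triv Dc] by simp
  moreover have "manifold_with_boundary 2 ?D (induced ?D (id ` nbrs H v))"
  proof (rule manifold_with_boundary)
    show "digital_space ?D" using digital_space_induced[OF space] .
    show "connected_graph ?D" using connected_induced_iff[OF space, of "pts H - {v}"] Dc by blast
    show "closed_manifold 2 H" by (rule closed_manifold_H)
    show "graph_iso id (delete_point H v) ?D" by (simp add: graph_iso_def delete_point_def bij_betw_id)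
  qed (simp_all add: v)
  moreover have "induced ?D (id ` nbrs H v) = induced H (nbrs H v)"
    unfolding image_id id_apply induced_induced
    by (rule arg_cong[where f = "induced H"]) (use nbrs_neq nbrs_subset[OF space] in blast)
  ultimately show ?thesis using disk_n[of 2] by simp
qed

lemma coh_trivial_imp_sphere:
  assumes triv: "coh_trivial H"
  shows "digital_sphere 2 H"
proof -
  obtain v where v: "v \<in> pts H" using conn by (auto simp: conn_on_def)
  let ?L = "nbrs H v"
  let ?D = "induced H (pts H - {v})" and ?C = "induced H (insert v ?L)" and ?B = "induced H ?L"
  \<comment> \<open>The renaming inside \<open>attach\<close> for the identity on the link: link
    points are taken from the \<open>Inl\<close> copy, so \<open>v\<close> is the only point tagged
    \<open>Inr\<close>, and \<open>g\<close> just forgets the tags.\<close>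
  define h where "h = (\<lambda>y. if y \<in> pts ?B then Inl (inv_into (pts ?B) id y) else Inr y :: 'a + 'a)"
  define g where "g = case_sum (\<lambda>x::'a. x) (\<lambda>x::'a. x)"
  have L: "?L \<subseteq> pts H" "v \<notin> ?L" using nbrs_subset[OF space] nbrs_neq by blast+
  have B: "pts ?B = ?L" using L by auto
  have hL: "h y = Inl y" if "y \<in> ?L" for y
    using that inv_into_f_f[of id ?L y] unfolding h_def B by simp
  have hv: "h v = Inr v" unfolding h_def B using L by simp
  let ?A = "attach id ?D ?B ?C ?B"
  have A: "?A = \<lparr>pts = Inl ` pts ?D \<union> h ` pts ?C,
      edges = map_prod Inl Inl ` edges ?D \<union> map_prod h h ` edges ?C\<rparr>"
    unfolding attach_def h_def Let_def ..
  have Ap: "pts ?A = insert (Inr v) (Inl ` (pts H - {v}))"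
    unfolding A using L v hL hv by auto
  have gI: "graph_iso g ?A H"
    unfolding graph_iso_def
  proof (intro conjI ballI)
    show "bij_betw g (pts ?A) (pts H)"
      unfolding Ap bij_betw_def
    proof
      show "inj_on g (insert (Inr v) (Inl ` (pts H - {v})))"
        by (rule inj_onI, elim insertE imageE) (simp_all add: g_def)
      show "g ` insert (Inr v) (Inl ` (pts H - {v})) = pts H"
        unfolding image_insert image_image g_def sum.case image_ident using v by blast
    qed
    have gh: "g (h y) = y" if "y \<in> insert v ?L" for y
      using that hL[of y] hv by (cases "y = v") (simp_all add: g_def)
    have gi: "(g x, g y) \<in> edges H" if xy: "(x, y) \<in> edges ?A" for x y
    proof -
      consider "(x, y) \<in> map_prod Inl Inl ` edges ?D" | "(x, y) \<in> map_prod h h ` edges ?C"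
        using xy unfolding A by fastforce
      then show ?thesis
      proof cases
        case 1
        then obtain a b where "x = Inl a" "y = Inl b" "(a, b) \<in> edges ?D" by blast
        then show ?thesis by (simp add: g_def)
      next
        case 2
        then obtain a b where "x = h a" "y = h b" "(a, b) \<in> edges ?C" by blast
        moreover from this(3) have "a \<in> insert v ?L" "b \<in> insert v ?L" "(a, b) \<in> edges H"
          unfolding edges_induced by blast+
        ultimately show ?thesis by (simp only: gh)
      qed
    qed
    \<comment> \<open>\<open>j\<close> inverts \<open>g\<close>. Edges at \<open>v\<close> are found
      in the star, all others in the complement of \<open>v\<close>.\<close>
    have gm: "(j x, j y) \<in> edges ?A" if xy: "(x, y) \<in> edges H" and j: "j = (\<lambda>x. if x = v then Inr v else Inl x)" for x y j
    proof (cases "x = v \<or> y = v")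
      case True
      have "x \<in> insert v ?L" "y \<in> insert v ?L" using True xy edgeD(3)[OF xy] nbrs_iff by blast+
      then have "(x, y) \<in> edges ?C" using xy unfolding edges_induced by blast
      moreover have "h z = j z" if "z \<in> insert v ?L" for z
        using that hL[of z] hv unfolding j by (cases "z = v") simp_all
      then have "h x = j x" "h y = j y" using \<open>x \<in> insert v ?L\<close> \<open>y \<in> insert v ?L\<close> by blast+
      ultimately have "(j x, j y) \<in> map_prod h h ` edges ?C" by (metis map_prod_imageI)
      then show ?thesis unfolding A by simp
    next
      case False
      then have "(x, y) \<in> edges ?D" "Inl x = j x" "Inl y = j y"
        using xy edgeD(1,2)[OF xy] unfolding j by simp_all
      then have "(j x, j y) \<in> map_prod Inl Inl ` edges ?D" by (metis map_prod_imageI)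
      then show ?thesis unfolding A by simp
    qed
    fix x y assume xy: "x \<in> pts ?A" "y \<in> pts ?A"
    define j where "j = (\<lambda>x. if x = v then Inr v else Inl x :: 'a + 'a)"
    have jg: "j (g z) = z" if z: "z \<in> pts ?A" for z
      using z unfolding Ap by (elim insertE imageE) (simp_all add: j_def g_def)
    show "(x, y) \<in> edges ?A \<longleftrightarrow> (g x, g y) \<in> edges H"
    proof
      assume "(g x, g y) \<in> edges H"
      from gm[OF this j_def] show "(x, y) \<in> edges ?A" unfolding jg[OF xy(1)] jg[OF xy(2)] .
    qed (rule gi)
  qed
  have "graph_iso id ?B ?B" by (simp add: graph_iso_def bij_betw_id)
  then show ?thesis
    using sphere_n[OF _ space complement_disk[OF triv v] star_disk[OF v] _ gI] by simp
qed

end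

subsection \<open>Shortest odd closed walks\<close>

text \<open>The numeric index is the length and the boolean one the sum of \<open>\<phi>\<close> mod
  two along the walk; both add under concatenation.\<close>

inductive pwalk :: "('a \<times> 'a) set \<Rightarrow> ('a \<Rightarrow> 'a \<Rightarrow> bool) \<Rightarrow> nat \<Rightarrow> bool \<Rightarrow> 'a \<Rightarrow> 'a \<Rightarrow> bool"
  for E \<phi> where
  pwalk_Nil: "pwalk E \<phi> 0 False a a"
| pwalk_Cons: "(a, b) \<in> E \<Longrightarrow> pwalk E \<phi> n p b c \<Longrightarrow> pwalk E \<phi> (Suc n) (\<phi> a b \<noteq> p) a c"

lemma pwalk_trans:
  "pwalk E \<phi> n p a b \<Longrightarrow> pwalk E \<phi> k q b c \<Longrightarrow> pwalk E \<phi> (n + k) (p \<noteq> q) a c"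
proof (induction rule: pwalk.induct)
  case (pwalk_Nil a)
  then show ?case by simp
next
  case (pwalk_Cons a b n p c')
  have "pwalk E \<phi> (Suc (n + k)) (\<phi> a b \<noteq> (p \<noteq> q)) a c"
    by (rule pwalk.pwalk_Cons[OF pwalk_Cons.hyps(1) pwalk_Cons.IH[OF pwalk_Cons.prems]])
  moreover have "(\<phi> a b \<noteq> (p \<noteq> q)) = ((\<phi> a b \<noteq> p) \<noteq> q)" by argo
  ultimately show ?case by simp
qed

lemma pwalk_edge: "(a, b) \<in> E \<Longrightarrow> pwalk E \<phi> 1 (\<phi> a b) a b"
  using pwalk_Cons[OF _ pwalk_Nil, of a b E \<phi>] by simp

lemma pwalk_rev:
  assumes "sym E" "\<And>x y. \<phi> x y = \<phi> y x"
  shows "pwalk E \<phi> n p a b \<Longrightarrow> pwalk E \<phi> n p b a"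
proof (induction rule: pwalk.induct)
  case (pwalk_Nil a)
  show ?case by (rule pwalk.pwalk_Nil)
next
  case (pwalk_Cons a b n p c)
  have "(b, a) \<in> E" using assms(1) pwalk_Cons.hyps(1) by (rule symD)
  from pwalk_trans[OF pwalk_Cons.IH pwalk_edge[OF this, of \<phi>]]
  have "pwalk E \<phi> (n + 1) (p \<noteq> \<phi> b a) c a" .
  moreover have "(p \<noteq> \<phi> b a) = (\<phi> a b \<noteq> p)" using assms(2)[of a b] by argo
  ultimately show ?case by simp
qed

primrec parity :: "('a \<Rightarrow> 'a \<Rightarrow> bool) \<Rightarrow> (nat \<Rightarrow> 'a) \<Rightarrow> nat \<Rightarrow> bool" where
  "parity \<phi> c 0 = False"
| "parity \<phi> c (Suc n) = (parity \<phi> c n \<noteq> \<phi> (c n) (c (Suc n)))"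

lemma parity_shift: "parity \<phi> c (Suc n) = (\<phi> (c 0) (c (Suc 0)) \<noteq> parity \<phi> (\<lambda>i. c (Suc i)) n)"
proof (induction n)
  case (Suc n)
  have "parity \<phi> c (Suc (Suc n)) = (parity \<phi> c (Suc n) \<noteq> \<phi> (c (Suc n)) (c (Suc (Suc n))))" by simp
  also have "\<dots> = (\<phi> (c 0) (c (Suc 0)) \<noteq> parity \<phi> (\<lambda>i. c (Suc i)) (Suc n))"
    unfolding Suc.IH parity.simps(2)[of \<phi> "\<lambda>i. c (Suc i)"] by argo
  finally show ?case .
qed simp

lemma parity_reverse:
  assumes "\<And>x y. \<phi> x y = \<phi> y x" "j \<le> m"
  shows "parity \<phi> (\<lambda>i. c (m - i)) j = (parity \<phi> c m \<noteq> parity \<phi> c (m - j))"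
  using assms(2)
proof (induction j)
  case (Suc j)
  define k where "k = m - Suc j"
  have k: "m - j = Suc k" "m - Suc j = k" using Suc.prems by (simp_all add: k_def)
  have IH: "parity \<phi> (\<lambda>i. c (m - i)) j = (parity \<phi> c m \<noteq> parity \<phi> c (Suc k))" using Suc k by simp
  show ?case
    unfolding parity.simps(2)[of \<phi> "\<lambda>i. c (m - i)"] IH k parity.simps(2)[of \<phi> c]
    using assms(1)[of "c k" "c (Suc k)"] by argo
qed simp

lemma pwalk_enum:
  "pwalk E \<phi> n p a b \<Longrightarrow>
    \<exists>c. c 0 = a \<and> c n = b \<and> (\<forall>i<n. (c i, c (Suc i)) \<in> E) \<and> p = parity \<phi> c n"
proof (induction rule: pwalk.induct)
  case (pwalk_Nil a)
  show ?case by (intro exI[of _ "\<lambda>_. a"]) simp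
next
  case (pwalk_Cons a b n p b')
  then obtain c where c: "c 0 = b" "c n = b'" "\<forall>i<n. (c i, c (Suc i)) \<in> E" "p = parity \<phi> c n" by blast
  have "(\<phi> a b \<noteq> p) = parity \<phi> (case_nat a c) (Suc n)"
    unfolding parity_shift using c by simp
  moreover have "\<forall>i<Suc n. (case_nat a c i, case_nat a c (Suc i)) \<in> E"
    using c pwalk_Cons.hyps(1) by (auto simp: less_Suc_eq_0_disj)
  ultimately show ?case using c(2) by (intro exI[of _ "case_nat a c"]) simp
qed

lemma pwalk_segment:
  assumes "\<forall>i<m. (c i, c (Suc i)) \<in> E" "i \<le> j" "j \<le> m"
  shows "pwalk E \<phi> (j - i) (parity \<phi> c i \<noteq> parity \<phi> c j) (c i) (c j)"
  using assms(2,3)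
proof (induction j rule: dec_induct)
  case base
  show ?case using pwalk_Nil[of E \<phi> "c i"] by simp
next
  case (step j)
  have "pwalk E \<phi> (j - i) (parity \<phi> c i \<noteq> parity \<phi> c j) (c i) (c j)" using step by simp
  moreover have "(c j, c (Suc j)) \<in> E" using assms(1) step by simp
  ultimately have "pwalk E \<phi> (j - i + 1) ((parity \<phi> c i \<noteq> parity \<phi> c j) \<noteq> \<phi> (c j) (c (Suc j))) (c i) (c (Suc j))"
    by (rule pwalk_trans[OF _ pwalk_edge])
  moreover have "((parity \<phi> c i \<noteq> parity \<phi> c j) \<noteq> \<phi> (c j) (c (Suc j))) = (parity \<phi> c i \<noteq> parity \<phi> c (Suc j))"
    unfolding parity.simps(2) by argo
  ultimately show ?case using step.hyps by (simp add: Suc_diff_le)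
qed

text \<open>The potential of a point is the parity of any walk to it from a base point
  \<open>r\<close>; two walks of different parity would combine to an odd closed walk.\<close>

lemma coboundary_if_no_odd_walk:
  fixes \<phi> :: "'a \<Rightarrow> 'a \<Rightarrow> bool"
  assumes E: "sym (edges G)" and \<phi>: "\<And>x y. \<phi> x y = \<phi> y x" and conn: "conn_on (edges G) (pts G)"
    and sub: "edges G \<subseteq> pts G \<times> pts G"
    and no: "\<And>n a. \<not> pwalk (edges G) \<phi> n True a a"
  shows "coboundary G \<phi>"
proof -
  obtain r where r: "r \<in> pts G" using conn unfolding conn_on_def by blast
  define f where "f x \<longleftrightarrow> (\<exists>n. pwalk (edges G) \<phi> n True r x)" for x
  have r0: "\<exists>n p. pwalk (edges G) \<phi> n p r r" using pwalk_Nil[of "edges G" \<phi> r] by (intro exI)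
  have reach: "\<exists>n p. pwalk (edges G) \<phi> n p r x" if "x \<in> pts G" for x
    using that
  proof (rule conn_on_induct[where P = "\<lambda>x. \<exists>n p. pwalk (edges G) \<phi> n p r x", OF conn r r0, rotated])
    fix x y assume xy: "(x, y) \<in> edges G" and "\<exists>n p. pwalk (edges G) \<phi> n p r x"
    then obtain n p where w: "pwalk (edges G) \<phi> n p r x" by (elim exE)
    from pwalk_trans[OF w pwalk_edge[OF xy, of \<phi>]]
    show "\<exists>n p. pwalk (edges G) \<phi> n p r y" by (intro exI)
  qed
  have fp: "f x = p" if w: "pwalk (edges G) \<phi> n p r x" for n p x
  proof (cases p)
    case True
    then have "pwalk (edges G) \<phi> n True r x" using w by simp
    then show ?thesis using True unfolding f_def by blast
  next
    case False
    have "\<not> f x"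
    proof
      assume "f x"
      then obtain k where k: "pwalk (edges G) \<phi> k True r x" unfolding f_def by blast
      from pwalk_trans[OF k pwalk_rev[OF E \<phi> w]] False no show False by simp
    qed
    with False show ?thesis by simp
  qed
  have "\<phi> x y = (f x \<noteq> f y)" if xy: "(x, y) \<in> edges G" for x y
  proof -
    have "x \<in> pts G" using xy sub by blast
    from reach[OF this] obtain n p where w: "pwalk (edges G) \<phi> n p r x" by (elim exE)
    from fp[OF w] fp[OF pwalk_trans[OF w pwalk_edge[OF xy, of \<phi>]]] show ?thesis by argo
  qed
  then show ?thesis unfolding coboundary_def by blast
qed

definition induced_path :: "'a graph \<Rightarrow> (nat \<Rightarrow> 'a) \<Rightarrow> nat \<Rightarrow> bool" where
  "induced_path G q l \<longleftrightarrow> q ` {..l} \<subseteq> pts G \<and> inj_on q {..l} \<and>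
     (\<forall>i\<le>l. \<forall>j\<le>l. (q i, q j) \<in> edges G \<longleftrightarrow> j = Suc i \<or> i = Suc j)"

text \<open>\<open>m + 2\<close> is the length of a shortest odd closed walk; the hypothesis \<open>engulfed\<close> is what an
  embedded one-disk supplies.\<close>

locale shortest_odd = finite_surface +
  fixes \<phi> :: "'a \<Rightarrow> 'a \<Rightarrow> bool" and m :: nat
  assumes cocycle: "cocycle H \<phi>"
    and m2: "m \<ge> 2"
    and minimal: "n < m + 2 \<Longrightarrow> \<not> pwalk (edges H) \<phi> n True a a"
    and engulfed: "induced_path H q l \<Longrightarrow> l \<ge> 2 \<Longrightarrow>
      \<exists>D. \<exists>f :: 'a \<Rightarrow> bool. (\<forall>x\<in>D. \<forall>y\<in>D. (x, y) \<in> edges H \<longrightarrow> \<phi> x y = (f x \<noteq> f y)) \<and>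
        (\<forall>i. 0 < i \<longrightarrow> i < l \<longrightarrow> q i \<in> D \<and> nbrs H (q i) \<subseteq> D)"
begin

lemmas \<phi>_sym = cocycleD(1)[OF cocycle] and \<phi>_tri = cocycleD(2)[OF cocycle]

lemma closed_even: "pwalk (edges H) \<phi> n p a a \<Longrightarrow> n < m + 2 \<Longrightarrow> \<not> p"
  using minimal by (cases p) auto

text \<open>The points \<open>a, p 0, \<dots>, p m\<close> form an odd closed walk of minimal length.\<close>

definition tight :: "(nat \<Rightarrow> 'a) \<Rightarrow> 'a \<Rightarrow> bool" where
  "tight p a \<longleftrightarrow> (\<forall>i<m. (p i, p (Suc i)) \<in> edges H) \<and> (a, p 0) \<in> edges H \<and> (a, p m) \<in> edges H \<and>
     (\<phi> a (p 0) \<noteq> (parity \<phi> p m \<noteq> \<phi> a (p m)))"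

lemma tightD:
  assumes "tight p a"
  shows "\<forall>i<m. (p i, p (Suc i)) \<in> edges H" "(a, p 0) \<in> edges H" "(a, p m) \<in> edges H"
    "\<phi> a (p 0) \<noteq> (parity \<phi> p m \<noteq> \<phi> a (p m))"
  using assms unfolding tight_def by blast+

section \<open>Rigidity of a shortest odd closed walk\<close>

lemma sym_edges: "sym (edges H)"
  using space by (simp add: digital_space_def)

text \<open>The shortcut and the segment it bypasses form a closed walk below the minimal length, so
  they have equal parity; exchanging them leaves an odd closed walk that is too short.\<close>

lemma tight_no_shortcut:
  assumes t: "tight p a" and ij: "i \<le> j" "j \<le> m"
    and w: "pwalk (edges H) \<phi> n q (p i) (p j)" and n: "n < j - i" "n + (j - i) < m + 2"
  shows False
proof -
  note td = tightD[OF t]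
  have "pwalk (edges H) \<phi> (n + (j - i)) (q \<noteq> (parity \<phi> p i \<noteq> parity \<phi> p j)) (p i) (p i)"
    by (rule pwalk_trans[OF w pwalk_rev[OF sym_edges \<phi>_sym pwalk_segment[OF td(1) ij]]])
  then have 1: "\<not> (q \<noteq> (parity \<phi> p i \<noteq> parity \<phi> p j))" using closed_even n(2) by blast
  have s1: "pwalk (edges H) \<phi> (i - 0) (parity \<phi> p 0 \<noteq> parity \<phi> p i) (p 0) (p i)"
    using ij by (intro pwalk_segment[OF td(1)]) simp_all
  have s2: "pwalk (edges H) \<phi> (m - j) (parity \<phi> p j \<noteq> parity \<phi> p m) (p j) (p m)"
    using ij by (intro pwalk_segment[OF td(1)]) simp_all
  have "pwalk (edges H) \<phi> (1 + ((i - 0) + (n + ((m - j) + 1))))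
      (\<phi> a (p 0) \<noteq> ((parity \<phi> p 0 \<noteq> parity \<phi> p i) \<noteq> (q \<noteq> ((parity \<phi> p j \<noteq> parity \<phi> p m) \<noteq> \<phi> (p m) a)))) a a"
    by (intro pwalk_trans[OF pwalk_edge[OF td(2)]] pwalk_trans[OF s1] pwalk_trans[OF w]
        pwalk_trans[OF s2] pwalk_edge[OF edgeD(3)[OF td(3)]])
  moreover have "1 + ((i - 0) + (n + ((m - j) + 1))) < m + 2" using ij n by linarith
  ultimately have "\<not> (\<phi> a (p 0) \<noteq> ((parity \<phi> p 0 \<noteq> parity \<phi> p i) \<noteq> (q \<noteq> ((parity \<phi> p j \<noteq> parity \<phi> p m) \<noteq> \<phi> (p m) a))))"
    by (rule closed_even)
  with 1 td(4) \<phi>_sym[of a "p m"] show False unfolding parity.simps(1) by argo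
qed

lemma tight_neq:
  assumes "tight p a" "i < j" "j \<le> m"
  shows "p i \<noteq> p j"
proof
  assume "p i = p j"
  then have "pwalk (edges H) \<phi> 0 False (p i) (p j)" using pwalk_Nil by metis
  from tight_no_shortcut[OF assms(1) _ assms(3) this] assms(2,3) show False by linarith
qed

lemma tight_chordless:
  assumes "tight p a" "i < j" "j \<le> m" "j \<noteq> Suc i"
  shows "(p i, p j) \<notin> edges H"
proof
  assume "(p i, p j) \<in> edges H"
  then have "pwalk (edges H) \<phi> 1 (\<phi> (p i) (p j)) (p i) (p j)" by (rule pwalk_edge)
  from tight_no_shortcut[OF assms(1) _ assms(3) this] assms(2-) show False by linarith
qed

text \<open>Rotation of the closed walk by one point. Conjugating with \<open>tight_reverse\<close>
  rotates the other way, so any point of the walk can be made the apex.\<close>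

lemma tight_shift:
  assumes t: "tight p a"
  shows "tight (case_nat a p) (p m)"
proof -
  note td = tightD[OF t]
  obtain k where k: "m = Suc k" using m2 by (cases m) auto
  have "(p k, p m) \<in> edges H" using td(1) k by simp
  from edgeD(3)[OF this] have 1: "(p m, case_nat a p m) \<in> edges H" using k by simp
  have 2: "(case_nat a p i, case_nat a p (Suc i)) \<in> edges H" if "i < m" for i
    using td(1,2) that by (cases i) simp_all
  have "parity \<phi> (case_nat a p) m = (\<phi> a (p 0) \<noteq> parity \<phi> p k)" unfolding k parity_shift by simp
  moreover have "parity \<phi> p m = (parity \<phi> p k \<noteq> \<phi> (p k) (p m))" unfolding k by simp
  ultimately have "\<phi> (p m) a \<noteq> (parity \<phi> (case_nat a p) m \<noteq> \<phi> (p m) (p k))"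
    using td(4) \<phi>_sym[of a "p m"] \<phi>_sym[of "p k" "p m"] by argo
  then have "\<phi> (p m) (case_nat a p 0) \<noteq> (parity \<phi> (case_nat a p) m \<noteq> \<phi> (p m) (case_nat a p m))"
    using k by simp
  then show ?thesis using 1 2 edgeD(3)[OF td(3)] unfolding tight_def by simp
qed

lemma tight_reverse:
  assumes t: "tight p a"
  shows "tight (\<lambda>i. p (m - i)) a"
proof -
  note td = tightD[OF t]
  have "(p (m - i), p (m - Suc i)) \<in> edges H" if "i < m" for i
  proof -
    have "(p (m - Suc i), p (Suc (m - Suc i))) \<in> edges H" using td(1) that by simp
    then show ?thesis using edgeD(3) that by (simp add: Suc_diff_Suc)
  qed
  moreover have "parity \<phi> (\<lambda>i. p (m - i)) m = parity \<phi> p m"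
    using parity_reverse[where c = p and j = m and m = m, OF \<phi>_sym] by simp
  moreover have "\<phi> a (p m) \<noteq> (parity \<phi> p m \<noteq> \<phi> a (p 0))" using td(4) by argo
  ultimately show ?thesis using td(2,3) unfolding tight_def by simp
qed

lemma tight_apex:
  assumes t: "tight p a"
  shows "a \<noteq> p 1" "(a, p 1) \<notin> edges H"
  using tight_neq[OF tight_shift[OF t], of 0 2] tight_chordless[OF tight_shift[OF t], of 0 2] m2
  by (simp_all add: numeral_2_eq_2)

text \<open>The apex of a shortest odd closed walk moves along the link of \<open>p 0\<close>: if \<open>y\<close> were not
  adjacent to \<open>p m\<close>, then \<open>y, p 0, \<dots>, p m\<close> would be an induced path, and the walk would lie in the
  region engulfing it, where \<open>\<phi>\<close> is a coboundary.\<close>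

lemma tight_step:
  assumes t: "tight p a" and ya: "(a, y) \<in> edges H" and y0: "(p 0, y) \<in> edges H"
    and y1: "y \<noteq> p 1" "(y, p 1) \<notin> edges H"
  shows "tight p y"
proof -
  note td = tightD[OF t]
  have ya': "(y, a) \<in> edges H" and y0': "(y, p 0) \<in> edges H" using edgeD(3) ya y0 by blast+
  have tri0: "\<phi> a (p 0) = (\<phi> a y \<noteq> \<phi> y (p 0))" by (rule \<phi>_tri[OF ya y0' td(2)])
  have "(y, p m) \<in> edges H"
  proof (rule ccontr)
    assume ym: "(y, p m) \<notin> edges H"
    \<comment> \<open>A chord from \<open>y\<close> to \<open>p j\<close> with
      \<open>2 \<le> j < m\<close> gives closed walks of lengths \<open>j + 2\<close> and
      \<open>m - j + 3\<close>, both below \<open>m + 2\<close> and hence even. Together with the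
      triangle \<open>a\<close>, \<open>y\<close>, \<open>p 0\<close> they sum to the odd
      walk.\<close>
    have nadj: "(y, p j) \<notin> edges H" if j: "0 < j" "j \<le> m" for j
    proof (cases "j = 1 \<or> j = m")
      case True
      then show ?thesis using y1 ym by blast
    next
      case False
      then have j': "2 \<le> j" "j < m" using j by linarith+
      show ?thesis
      proof
        assume yj: "(y, p j) \<in> edges H"
        have s1: "pwalk (edges H) \<phi> (j - 0) (parity \<phi> p 0 \<noteq> parity \<phi> p j) (p 0) (p j)"
          using j by (intro pwalk_segment[OF td(1)]) simp_all
        have s2: "pwalk (edges H) \<phi> (m - j) (parity \<phi> p j \<noteq> parity \<phi> p m) (p j) (p m)"
          using j by (intro pwalk_segment[OF td(1)]) simp_all
        have "pwalk (edges H) \<phi> (1 + ((j - 0) + 1)) (\<phi> y (p 0) \<noteq> ((parity \<phi> p 0 \<noteq> parity \<phi> p j) \<noteq> \<phi> (p j) y)) y y"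
          by (intro pwalk_trans[OF pwalk_edge[OF y0']] pwalk_trans[OF s1] pwalk_edge[OF edgeD(3)[OF yj]])
        then have 1: "\<not> (\<phi> y (p 0) \<noteq> ((parity \<phi> p 0 \<noteq> parity \<phi> p j) \<noteq> \<phi> (p j) y))"
          by (rule closed_even) (use j' in linarith)
        have "pwalk (edges H) \<phi> (1 + (1 + ((m - j) + 1)))
            (\<phi> a y \<noteq> (\<phi> y (p j) \<noteq> ((parity \<phi> p j \<noteq> parity \<phi> p m) \<noteq> \<phi> (p m) a))) a a"
          by (intro pwalk_trans[OF pwalk_edge[OF ya]] pwalk_trans[OF pwalk_edge[OF yj]]
              pwalk_trans[OF s2] pwalk_edge[OF edgeD(3)[OF td(3)]])
        then have 2: "\<not> (\<phi> a y \<noteq> (\<phi> y (p j) \<noteq> ((parity \<phi> p j \<noteq> parity \<phi> p m) \<noteq> \<phi> (p m) a)))"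
          by (rule closed_even) (use j' in linarith)
        show False
          using 1 2 tri0 td(4) \<phi>_sym[of a "p m"] \<phi>_sym[of y "p j"] unfolding parity.simps(1) by argo
      qed
    qed
    have yne: "y \<noteq> p j" if "j \<le> m" for j
    proof
      assume yj: "y = p j"
      show False
      proof (cases "j = 0")
        case True
        then show False using edgeD(4)[OF y0] yj by simp
      next
        case False
        then have "j \<noteq> Suc 0" using y1(1) yj by auto
        then show False using tight_chordless[OF t, of 0 j] False that y0 yj by simp
      qed
    qed
    define q where "q = case_nat y p"
    have q: "q 0 = y" "\<And>i. q (Suc i) = p i" by (simp_all add: q_def)
    have "induced_path H q (Suc m)"
      unfolding induced_path_def
    proof (intro conjI allI impI)
      have pH: "p i \<in> pts H" if "i \<le> m" for i
      proof (cases "i = m")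
        case True
        then show ?thesis using edgeD(2)[OF td(3)] by simp
      next
        case False
        then have "(p i, p (Suc i)) \<in> edges H" using td(1) that by simp
        then show ?thesis by (rule edgeD(1))
      qed
      show "q ` {..Suc m} \<subseteq> pts H"
      proof
        fix x assume "x \<in> q ` {..Suc m}"
        then obtain i where i: "i \<le> Suc m" "x = q i" by blast
        show "x \<in> pts H" using i pH edgeD(1)[OF ya'] q by (cases i) simp_all
      qed
      have ne: "q i \<noteq> q j" if ij: "i < j" "j \<le> Suc m" for i j
      proof -
        obtain j' where j': "j = Suc j'" using ij(1) by (cases j) auto
        show ?thesis using ij j' q yne tight_neq[OF t] by (cases i) simp_all
      qed
      show "inj_on q {..Suc m}"
        by (rule inj_onI) (metis atMost_iff linorder_neqE_nat ne)
      have adj: "(q i, q j) \<in> edges H \<longleftrightarrow> j = Suc i" if ij: "i < j" "j \<le> Suc m" for i j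
      proof -
        obtain j' where j': "j = Suc j'" using ij(1) by (cases j) auto
        show ?thesis
        proof (cases i)
          case 0
          then show ?thesis using j' q nadj[of j'] y0' ij by (cases "j' = 0") simp_all
        next
          case (Suc i')
          then show ?thesis
            using j' q tight_chordless[OF t, of i' j'] td(1) ij by (cases "j' = Suc i'") simp_all
        qed
      qed
      fix i j assume ij: "i \<le> Suc m" "j \<le> Suc m"
      consider "i < j" | "i = j" | "j < i" by linarith
      then show "(q i, q j) \<in> edges H \<longleftrightarrow> j = Suc i \<or> i = Suc j"
      proof cases
        case 1
        then show ?thesis using adj[of i j] ij by simp
      next
        case 2
        then show ?thesis using edgeD(4)[of "q i" "q j"] by auto
      next
        case 3
        have "(q i, q j) \<in> edges H \<longleftrightarrow> (q j, q i) \<in> edges H" using edgeD(3) by blast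
        then show ?thesis using adj[of j i] ij 3 by simp
      qed
    qed
    moreover have "Suc m \<ge> 2" using m2 by simp
    note engulfed[OF calculation this]
    then obtain D and f :: "'a \<Rightarrow> bool"
      where f: "\<forall>x\<in>D. \<forall>y\<in>D. (x, y) \<in> edges H \<longrightarrow> \<phi> x y = (f x \<noteq> f y)"
        and D: "\<forall>i. 0 < i \<longrightarrow> i < Suc m \<longrightarrow> q i \<in> D \<and> nbrs H (q i) \<subseteq> D"
      by (elim exE conjE)
    have D': "p i \<in> D" "nbrs H (p i) \<subseteq> D" if "i < m" for i
      using D[rule_format, of "Suc i"] that q by simp_all
    \<comment> \<open>\<open>a\<close> is not on the path, but it is adjacent to \<open>p 0\<close>,
      which is inner because the path starts at \<open>y\<close>. In the same way the end point
      \<open>p m\<close> is caught as a neighbour of the inner point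
      \<open>p (m - 1)\<close>.\<close>
    have aD: "a \<in> D" using D'(2)[of 0] m2 edgeD(3)[OF td(2)] nbrs_iff by auto
    have pD: "p i \<in> D" if "i \<le> m" for i
    proof (cases "i < m")
      case True then show ?thesis by (rule D')
    next
      case False
      then have i: "i = Suc (m - 1)" using that m2 by simp
      have "(p (m - 1), p (Suc (m - 1))) \<in> edges H" using td(1)[rule_format, of "m - 1"] m2 by linarith
      then show ?thesis using D'(2)[of "m - 1"] m2 nbrs_iff i by auto
    qed
    have "parity \<phi> p i = (f (p 0) \<noteq> f (p i))" if "i \<le> m" for i
      using that
    proof (induction i)
      case (Suc i)
      have "\<phi> (p i) (p (Suc i)) = (f (p i) \<noteq> f (p (Suc i)))"
        using f pD[of i] pD[of "Suc i"] td(1) Suc.prems by simp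
      with Suc show ?case unfolding parity.simps(2) by auto
    qed simp
    from this[of m] have "parity \<phi> p m = (f (p 0) \<noteq> f (p m))" by simp
    moreover have "\<phi> a (p 0) = (f a \<noteq> f (p 0))" "\<phi> a (p m) = (f a \<noteq> f (p m))"
      using f aD pD[of 0] pD[of m] td(2,3) by simp_all
    ultimately show False using td(4) by argo
  qed
  moreover have "\<phi> a (p m) = (\<phi> a y \<noteq> \<phi> y (p m))" by (rule \<phi>_tri[OF ya calculation td(3)])
  then have "\<phi> y (p 0) \<noteq> (parity \<phi> p m \<noteq> \<phi> y (p m))" using tri0 td(4) by argo
  ultimately show ?thesis using y0' td(1) unfolding tight_def by blast
qed

text \<open>Replacing \<open>b\<close>, \<open>p 0\<close>, \<open>p 1\<close>, \<open>p 2\<close>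
  by \<open>b\<close>, \<open>q\<close>, \<open>p 2\<close> saves one step, and the three triangles
  at \<open>q\<close> show that it preserves the parity.\<close>

lemma tight_no_bridge:
  assumes t: "tight p b" and q: "(b, q) \<in> edges H" "(q, p 0) \<in> edges H" "(q, p 1) \<in> edges H" "(q, p 2) \<in> edges H"
  shows False
proof -
  note td = tightD[OF t]
  have p01: "(p 0, p 1) \<in> edges H" "(p 1, p 2) \<in> edges H"
    using td(1)[rule_format, of 0] td(1)[rule_format, of 1] m2 by (simp_all add: numeral_2_eq_2)
  have s: "pwalk (edges H) \<phi> (m - 2) (parity \<phi> p 2 \<noteq> parity \<phi> p m) (p 2) (p m)"
    using m2 by (intro pwalk_segment[OF td(1)]) simp_all
  have "pwalk (edges H) \<phi> (1 + (1 + ((m - 2) + 1)))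
      (\<phi> b q \<noteq> (\<phi> q (p 2) \<noteq> ((parity \<phi> p 2 \<noteq> parity \<phi> p m) \<noteq> \<phi> (p m) b))) b b"
    by (intro pwalk_trans[OF pwalk_edge[OF q(1)]] pwalk_trans[OF pwalk_edge[OF q(4)]]
        pwalk_trans[OF s] pwalk_edge[OF edgeD(3)[OF td(3)]])
  then have 1: "\<not> (\<phi> b q \<noteq> (\<phi> q (p 2) \<noteq> ((parity \<phi> p 2 \<noteq> parity \<phi> p m) \<noteq> \<phi> (p m) b)))"
    by (rule closed_even) (use m2 in linarith)
  have par2: "parity \<phi> p 2 = (\<phi> (p 0) (p 1) \<noteq> \<phi> (p 1) (p 2))" by (simp add: numeral_2_eq_2)
  have "\<phi> b (p 0) = (\<phi> b q \<noteq> \<phi> q (p 0))" by (rule \<phi>_tri[OF q(1,2) td(2)])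
  moreover have "\<phi> q (p 1) = (\<phi> q (p 0) \<noteq> \<phi> (p 0) (p 1))" by (rule \<phi>_tri[OF q(2) p01(1) q(3)])
  moreover have "\<phi> q (p 2) = (\<phi> q (p 1) \<noteq> \<phi> (p 1) (p 2))" by (rule \<phi>_tri[OF q(3) p01(2) q(4)])
  ultimately show False using 1 td(4) \<phi>_sym[of b "p m"] unfolding par2 by argo
qed

text \<open>The apex can be moved to both ends \<open>c 2\<close> and \<open>c (n - 2)\<close> of
  the arc of points not adjacent to \<open>p 1\<close>. The walk with apex \<open>c (n - 2)\<close>
  is then read with apex \<open>p 1\<close>, and this apex moves to \<open>c 1\<close>. So
  \<open>c 1\<close> is adjacent to \<open>p 2\<close> and bridges the walk with apex
  \<open>c 2\<close>.\<close>

lemma tight_long_link: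
  assumes t: "tight p a" and c: "cycle_enum (rim H (p 0)) n c" "c 0 = p 1" and n: "n \<ge> 5"
  shows False
proof -
  note td = tightD[OF t]
  note N = link_cycleD(2)[OF c(1)] and inj = link_cycleD(3)[OF c(1)] and E = link_cycleD(4)[OF c(1)]
  have cN: "(p 0, c i) \<in> edges H" if "i < n" for i using N that nbrs_iff by blast
  have c1: "c i \<noteq> p 1" "(c i, p 1) \<notin> edges H" if "2 \<le> i" "i \<le> n - 2" for i
  proof -
    have i: "i < n" "0 < n" using that n by linarith+
    show "c i \<noteq> p 1" using inj_onD[OF inj, of i 0] i that c(2) by auto
    have "(c i, c 0) \<notin> edges H" unfolding E[OF i] using that n by auto
    then show "(c i, p 1) \<notin> edges H" using c(2) by simp
  qed
  \<comment> \<open>By \<open>tight_apex\<close> the index \<open>k\<close> lies between 2 and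
    \<open>n - 2\<close>; from there \<open>tight_step\<close> moves the apex along the link in both
    directions.\<close>
  obtain k where k: "k < n" "a = c k" using edgeD(3)[OF td(2)] nbrs_iff N by blast
  have "k \<noteq> 0" using tight_apex(1)[OF t] k(2) c(2) by metis
  moreover have "\<not> (k = 1 \<or> k = n - 1)"
  proof
    assume "k = 1 \<or> k = n - 1"
    then have "(c k, c 0) \<in> edges H" using E[of k 0] k(1) n by auto
    then show False using tight_apex(2)[OF t] k(2) c(2) by simp
  qed
  ultimately have k2: "2 \<le> k" "k \<le> n - 2" using k(1) by linarith+
  have tk: "tight p (c k)" using t k(2) by simp
  have adj: "(c i, c (Suc i)) \<in> edges H" "(c (Suc i), c i) \<in> edges H" if "Suc i < n" for i
    using E[of i "Suc i"] E[of "Suc i" i] that by simp_all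
  have up: "tight p (c i)" if "k \<le> i" "i \<le> n - 2" for i
    using that
  proof (induction i rule: dec_induct)
    case (step i)
    then have i: "Suc i < n" "2 \<le> Suc i" "Suc i \<le> n - 2" "i \<le> n - 2" using k2 n by linarith+
    show ?case
      by (rule tight_step[OF step.IH[OF i(4)] adj(1)[OF i(1)] cN[OF i(1)] c1[OF i(2,3)]])
  qed (rule tk)
  have down: "tight p (c i)" if "i \<le> k" "2 \<le> i" for i
    using that
  proof (induction i rule: inc_induct)
    case (step i)
    then have i: "Suc i < n" "2 \<le> i" "i \<le> n - 2" "i < n" using k2 n by linarith+
    have "tight p (c (Suc i))" using step i(2) by simp
    then show ?case
      by (rule tight_step[OF _ adj(2)[OF i(1)] cN[OF i(4)] c1[OF i(2,3)]])
  qed (rule tk)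
  let ?b = "c (n - 2)" and ?q = "c 1"
  have tb: "tight p ?b" using up k2 by simp
  have tb': "tight p (c 2)" using down k2 by simp
  \<comment> \<open>The reversed walk rotated twice: it runs through \<open>p 0\<close>,
    \<open>?b\<close>, \<open>p m\<close>, and down to \<open>p 2\<close>, with apex
    \<open>p 1\<close>.\<close>
  define r where "r = case_nat (p 0) (case_nat ?b (\<lambda>i. p (m - i)))"
  have "tight r (case_nat ?b (\<lambda>i. p (m - i)) m)"
    using tight_shift[OF tight_shift[OF tight_reverse[OF tb]]] unfolding r_def by simp
  moreover have "case_nat ?b (\<lambda>i. p (m - i)) m = p 1" using m2 by (cases m) (simp_all add: le_Suc_eq)
  ultimately have tr: "tight r (p 1)" by simp
  have r: "r 0 = p 0" "r 1 = ?b" by (simp_all add: r_def)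
  have rm: "r m = p 2"
  proof -
    obtain k where "m = Suc (Suc k)" using m2 by (metis add_2_eq_Suc le_Suc_ex)
    then show ?thesis unfolding r_def by (simp add: numeral_2_eq_2)
  qed
  have n1: "1 < n" "n - 2 < n" "0 < n" "2 < n" using n by linarith+
  have q1: "(p 1, ?q) \<in> edges H" using E[OF n1(3,1)] c(2) by simp
  have q2: "(c 2, ?q) \<in> edges H" using E[OF n1(4,1)] by simp
  have "?q \<noteq> r 1" using inj_onD[OF inj, of 1 "n - 2"] n1 n r by auto
  \<comment> \<open>Here the length of the link matters: \<open>c 1\<close> and
    \<open>c (n - 2)\<close> would be neighbours if \<open>n\<close> were 4.\<close>
  moreover have "(?q, r 1) \<notin> edges H" unfolding r E[OF n1(1,2)] using n by auto
  moreover have "(r 0, ?q) \<in> edges H" unfolding r by (rule cN[OF n1(1)])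
  ultimately have "tight r ?q" using tight_step[OF tr q1] by blast
  then have "(?q, p 2) \<in> edges H" using tightD(3) rm by metis
  then show False
    using tight_no_bridge[OF tb' q2] edgeD(3)[OF cN[OF n1(1)]] edgeD(3)[OF q1] by blast
qed

text \<open>A link of length four is avoided by moving on to the next point of the walk.\<close>

lemma no_tight: "\<not> tight p a"
proof
  assume t: "tight p a"
  note td = tightD[OF t]
  have p01: "(p 0, p 1) \<in> edges H" "(p 1, p 2) \<in> edges H"
    using td(1)[rule_format, of 0] td(1)[rule_format, of 1] m2 by (simp_all add: numeral_2_eq_2)
  have "p 1 \<in> nbrs H (p 0)" using p01 nbrs_iff by blast
  then obtain n c where c: "cycle_enum (rim H (p 0)) n c" "c 0 = p 1"
    using link_cycle[OF edgeD(1)[OF p01(1)]] by metis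
  have "\<not> n \<ge> 5" using tight_long_link[OF t c] by blast
  then have n: "n = 4" using link_cycleD(1)[OF c(1)] by linarith
  note N = link_cycleD(2)[OF c(1)] and E = link_cycleD(4)[OF c(1)]
  have "a \<in> c ` {..<4}" using edgeD(3)[OF td(2)] nbrs_iff N n by blast
  then obtain k where k: "k < 4" "a = c k" by blast
  have "k \<noteq> 0" using tight_apex(1)[OF t] k(2) c(2) by metis
  moreover have "\<not> (k = 1 \<or> k = 3)" using tight_apex(2)[OF t] k c(2) E[of k 0] n by auto
  ultimately have "k = 2" using k(1) by linarith
  let ?q = "c 1"
  have q: "(a, ?q) \<in> edges H" "(?q, p 1) \<in> edges H" "(p 0, ?q) \<in> edges H"
    using E[of 2 1] E[of 1 0] n k(2) \<open>k = 2\<close> c(2) N nbrs_iff by auto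
  \<comment> \<open>The walk with its first point made the apex: \<open>s\<close> runs through
    \<open>p 1\<close>, ..., \<open>p m\<close>, \<open>a\<close>, with apex \<open>p 0\<close>, so
    \<open>tight_long_link\<close> now applies to the link of \<open>p 1\<close>.\<close>
  define s where "s = (\<lambda>i. case_nat a (\<lambda>i. p (m - i)) (m - i))"
  have ts: "tight s (p 0)"
    using tight_reverse[OF tight_shift[OF tight_reverse[OF t]]] unfolding s_def by simp
  obtain m' where m': "m = Suc (Suc m')" using m2 by (metis add_2_eq_Suc le_Suc_ex)
  have s: "s 0 = p 1" "s 1 = p 2" unfolding s_def m' by (simp_all add: numeral_2_eq_2)
  have "p 2 \<in> nbrs H (p 1)" using p01 nbrs_iff by blast
  then obtain n' c' where c': "cycle_enum (rim H (p 1)) n' c'" "c' 0 = p 2"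
    using link_cycle[OF edgeD(1)[OF p01(2)]] by metis
  have "\<not> n' \<ge> 5" using tight_long_link[OF ts, of n' c'] c' s by metis
  then have n': "n' = 4" using link_cycleD(1)[OF c'(1)] by linarith
  note N' = link_cycleD(2)[OF c'(1)] and E' = link_cycleD(4)[OF c'(1)]
  have "p 0 \<in> c' ` {..<4}" using edgeD(3)[OF p01(1)] nbrs_iff N' n' by blast
  then obtain i where i: "i < 4" "p 0 = c' i" by blast
  have "?q \<in> c' ` {..<4}" using edgeD(3)[OF q(2)] nbrs_iff N' n' by blast
  then obtain j where j: "j < 4" "?q = c' j" by blast
  \<comment> \<open>In the 4-cycle around \<open>p 1\<close> the points \<open>p 0\<close> and
    \<open>p 2\<close> are opposite, so \<open>?q\<close>, being a neighbour of \<open>p 0\<close>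
    on it, is also adjacent to \<open>p 2\<close> and bridges the walk.\<close>
  have "p 0 \<noteq> p 2" "(p 0, p 2) \<notin> edges H"
    using tight_neq[OF t, of 0 2] tight_chordless[OF t, of 0 2] m2 by simp_all
  moreover from this have "i \<noteq> 0" using i(2) c'(2) by metis
  ultimately have "i \<noteq> 0" "\<not> (i = 1 \<or> i = 3)" using i c'(2) E'[of i 0] n' by auto
  then have "i = 2" using i(1) by linarith
  then have "(c' 2, c' j) \<in> edges H" using q(3) i j by simp
  then have "j = 1 \<or> j = 3" using E'[of 2 j] j(1) n' by auto
  then have "(?q, p 2) \<in> edges H" using E'[of j 0] j n' c'(2) by auto
  then show False using tight_no_bridge[OF t q(1) edgeD(3)[OF q(3)] q(2)] by blast
qed

end

context finite_surface
begin

lemma coboundary_if_engulfed: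
  fixes \<phi> :: "'a \<Rightarrow> 'a \<Rightarrow> bool"
  assumes \<phi>: "cocycle H \<phi>"
    and engulfed: "\<And>q l. induced_path H q l \<Longrightarrow> l \<ge> 2 \<Longrightarrow>
      \<exists>D. \<exists>f :: 'a \<Rightarrow> bool. (\<forall>x\<in>D. \<forall>y\<in>D. (x, y) \<in> edges H \<longrightarrow> \<phi> x y = (f x \<noteq> f y)) \<and>
        (\<forall>i. 0 < i \<longrightarrow> i < l \<longrightarrow> q i \<in> D \<and> nbrs H (q i) \<subseteq> D)"
  shows "coboundary H \<phi>"
proof (rule coboundary_if_no_odd_walk)
  show sym: "sym (edges H)" and "edges H \<subseteq> pts H \<times> pts H"
    using space unfolding digital_space_def by blast+
  show "conn_on (edges H) (pts H)" by (rule conn)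
  show \<phi>_sym: "\<phi> x y = \<phi> y x" for x y by (rule cocycleD(1)[OF \<phi>])
  show "\<not> pwalk (edges H) \<phi> n True a a" for n a
  proof
    assume "pwalk (edges H) \<phi> n True a a"
    then have ex: "\<exists>n a. pwalk (edges H) \<phi> n True a a" by (intro exI)
    define k where "k = (LEAST n. \<exists>a. pwalk (edges H) \<phi> n True a a)"
    have "\<exists>a. pwalk (edges H) \<phi> k True a a"
      unfolding k_def using ex by (rule LeastI_ex)
    then obtain b where b: "pwalk (edges H) \<phi> k True b b" by (elim exE)
    have minimal: "\<not> pwalk (edges H) \<phi> n True a a" if "n < k" for n a
      using not_less_Least[OF that[unfolded k_def]] by simp
    obtain c where c: "c 0 = b" "c k = b" "\<forall>i<k. (c i, c (Suc i)) \<in> edges H" "parity \<phi> c k"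
      using pwalk_enum[OF b] by blast
    \<comment> \<open>Closed walks of length at most three are even: there are no loops, a backtrack
      cancels, and a triangle is even by the cocycle condition. Hence \<open>k - 2\<close> is at
      least 2.\<close>
    have k0: "k \<noteq> 0" using c(4) by (cases k) auto
    have k1: "k \<noteq> 1"
    proof
      assume "k = 1"
      then have "(b, b) \<in> edges H" using c by auto
      then show False using edgeD(4) by blast
    qed
    have k2: "k \<noteq> 2"
    proof
      assume "k = 2"
      then have "parity \<phi> c (Suc (Suc 0))" "c (Suc (Suc 0)) = c 0" using c by (simp_all add: numeral_2_eq_2)
      then show False using \<phi>_sym[of "c 0" "c (Suc 0)"] by simp
    qed
    have k3: "k \<noteq> 3"
    proof
      assume k: "k = 3"
      then have p: "parity \<phi> c (Suc (Suc (Suc 0)))" and e: "c (Suc (Suc (Suc 0))) = c 0"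
        using c by (simp_all add: numeral_3_eq_3)
      have E: "(c 0, c (Suc 0)) \<in> edges H" "(c (Suc 0), c (Suc (Suc 0))) \<in> edges H"
          "(c (Suc (Suc 0)), c 0) \<in> edges H"
        using c(3)[rule_format, of 0] c(3)[rule_format, of 1] c(3)[rule_format, of 2] k e
        by (simp_all add: numeral_2_eq_2)
      have "\<phi> (c 0) (c (Suc (Suc 0))) = (\<phi> (c 0) (c (Suc 0)) \<noteq> \<phi> (c (Suc 0)) (c (Suc (Suc 0))))"
        by (rule cocycleD(2)[OF \<phi> E(1,2) edgeD(3)[OF E(3)]])
      then show False using p \<phi>_sym[of "c 0" "c (Suc (Suc 0))"] unfolding parity.simps e by argo
    qed
    define m where "m = k - 2"
    have m: "k = Suc (Suc m)" "m \<ge> 2" using k0 k1 k2 k3 unfolding m_def by linarith+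
    interpret shortest_odd H \<phi> m
      by unfold_locales (use \<phi> m minimal engulfed in simp_all)
    have "tight (\<lambda>i. c (Suc i)) (c 0)"
      unfolding tight_def
    proof (intro conjI allI impI)
      show "(c (Suc i), c (Suc (Suc i))) \<in> edges H" if "i < m" for i using c(3) m that by simp
      show "(c 0, c (Suc 0)) \<in> edges H" using c(3) m by simp
      have e: "c (Suc (Suc m)) = c 0" using c m by simp
      have "(c (Suc m), c (Suc (Suc m))) \<in> edges H" using c(3) m by simp
      then show "(c 0, c (Suc m)) \<in> edges H" using edgeD(3) e by simp
      have "parity \<phi> c (Suc (Suc m))" using c(4) m by simp
      then have "parity \<phi> c (Suc m) \<noteq> \<phi> (c (Suc m)) (c 0)" unfolding parity.simps(2)[of \<phi> c "Suc m"] e .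
      then show "\<phi> (c 0) (c (Suc 0)) \<noteq> (parity \<phi> (\<lambda>i. c (Suc i)) m \<noteq> \<phi> (c 0) (c (Suc m)))"
        unfolding parity_shift using \<phi>_sym[of "c 0" "c (Suc m)"] by argo
    qed
    then show False using no_tight by blast
  qed
qed

subsection \<open>Embedded one-disks\<close>

text \<open>A new point joined to both ends closes the path to a cycle of \<open>l + 2\<close>
  points, and \<open>2 \<le> l\<close> makes this at least four.\<close>

lemma path_disk:
  assumes q: "induced_path H q l" and l: "l \<ge> 2"
  shows "digital_disk 1 (induced H (q ` {..l})) (induced H {q 0, q l})"
proof -
  let ?P = "q ` {..l}"
  let ?D = "induced H ?P"
  have P: "?P \<subseteq> pts H" and inj: "inj_on q {..l}"
    and E: "\<And>i j. i \<le> l \<Longrightarrow> j \<le> l \<Longrightarrow> (q i, q j) \<in> edges H \<longleftrightarrow> j = Suc i \<or> i = Suc j"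
    using q unfolding induced_path_def by blast+
  obtain w where w: "w \<notin> pts H" using ex_new_if_finite[OF infinite_UNIV fin] by blast
  have wP: "w \<notin> ?P" using w P by blast
  have ends: "{q 0, q l} \<subseteq> ?P" by blast
  define S where "S = \<lparr>pts = insert w ?P,
     edges = edges H \<inter> (?P \<times> ?P) \<union> {w} \<times> {q 0, q l} \<union> {q 0, q l} \<times> {w}\<rparr>"
  have Sp: "pts S = insert w ?P" by (simp add: S_def)
  have Se: "(x, y) \<in> edges S \<longleftrightarrow> (x, y) \<in> edges H \<and> x \<in> ?P \<and> y \<in> ?P \<or>
      x = w \<and> y \<in> {q 0, q l} \<or> y = w \<and> x \<in> {q 0, q l}" for x y
    unfolding S_def graph.select_convs Un_iff Int_iff mem_Times_iff fst_conv snd_conv singleton_iff by blast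
  have spS: "digital_space S"
    unfolding digital_space_def
  proof (intro conjI)
    show "countable (pts S)" unfolding Sp by (intro countable_finite) simp
    show "edges S \<subseteq> pts S \<times> pts S" unfolding S_def by auto
    show "sym (edges S)"
    proof (rule symI)
      fix x y assume "(x, y) \<in> edges S"
      then show "(y, x) \<in> edges S" unfolding Se using edgeD(3)[of x y] by blast
    qed
    show "irrefl (edges S)"
    proof (rule irreflI)
      show "(x, x) \<notin> edges S" for x unfolding Se using edgeD(4)[of x x] wP ends by blast
    qed
  qed
  define c where "c i = (if i \<le> l then q i else w)" for i
  have qw: "q i \<noteq> w" if "i \<le> l" for i using wP that by blast
  have q_inj: "q i = q j \<longleftrightarrow> i = j" if "i \<le> l" "j \<le> l" for i j
    using inj that by (simp add: inj_on_eq_iff)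
  have "cycle_enum S (l + 2) c"
    unfolding cycle_enum_def
  proof (intro conjI allI impI)
    show "4 \<le> l + 2" using l by simp
    have "{..<l + 2} = insert (Suc l) {..l}" by auto
    moreover have "c ` {..l} = ?P" by (rule image_cong) (simp_all add: c_def)
    moreover have "c (Suc l) = w" by (simp add: c_def)
    ultimately show "pts S = c ` {..<l + 2}" unfolding Sp by simp
    show "inj_on c {..<l + 2}"
      unfolding inj_on_def c_def using q_inj qw qw[symmetric] by auto
    fix i j assume ij: "i < l + 2" "j < l + 2"
    consider "i \<le> l" "j \<le> l" | "i \<le> l" "j = Suc l" | "i = Suc l" "j \<le> l" | "i = Suc l" "j = Suc l"
      using ij by linarith
    then show "(c i, c j) \<in> edges S \<longleftrightarrow>
        j = Suc i \<or> i = Suc j \<or> i = 0 \<and> j = l + 2 - 1 \<or> j = 0 \<and> i = l + 2 - 1"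
    proof cases
      case 1
      then have "(c i, c j) \<in> edges S \<longleftrightarrow> (q i, q j) \<in> edges H" unfolding Se c_def using qw by simp
      then show ?thesis using E[OF 1] 1 by simp
    next
      case 2
      then have "(c i, c j) \<in> edges S \<longleftrightarrow> q i = q 0 \<or> q i = q l" unfolding Se c_def using qw wP by simp
      then show ?thesis using 2 q_inj[of i 0] q_inj[of i l] by auto
    next
      case 3
      then have "(c i, c j) \<in> edges S \<longleftrightarrow> q j = q 0 \<or> q j = q l" unfolding Se c_def using qw wP by simp
      then show ?thesis using 3 q_inj[of j 0] q_inj[of j l] by auto
    next
      case 4
      then show ?thesis using edgesD(4)[OF spS, of "c i" "c j"] l by auto
    qed
  qed
  then have S1: "digital_sphere 1 S" by (rule cycle_enum_sphere1[OF spS])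
  have wS: "nbrs S w = {q 0, q l}"
    unfolding nbrs_def Se using wP ends by blast
  have "graph_iso id (delete_point S w) ?D"
  proof -
    have p: "pts (delete_point S w) = ?P" using wP by (auto simp: delete_point_def Sp)
    have p': "pts ?D = ?P" using P by auto
    have "(x, y) \<in> edges (delete_point S w) \<longleftrightarrow> (x, y) \<in> edges ?D" if "x \<in> ?P" "y \<in> ?P" for x y
    proof -
      have "x \<noteq> w" "y \<noteq> w" using that wP by blast+
      then show ?thesis
        using that unfolding delete_point_def edges_induced Int_iff mem_Times_iff fst_conv snd_conv Sp Se by blast
    qed
    then show ?thesis unfolding graph_iso_def p p' by (simp add: bij_betw_id)
  qed
  then have "digital_disk 1 ?D (induced ?D (id ` nbrs S w))"
    by (intro disk_1[OF digital_space_induced[OF space] S1]) (simp_all add: Sp)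
  moreover have "induced ?D (id ` nbrs S w) = induced H {q 0, q l}"
    unfolding wS image_id id_apply induced_induced
    by (rule arg_cong[where f = "induced H"]) (use ends in blast)
  ultimately show ?thesis by simp
qed

text \<open>An interior point of a 2-disk has a cycle as its link in the disk; being 2-regular, this
  cycle exhausts the link in the surface.\<close>

lemma disk_interior_nbrs:
  assumes D: "digital_disk 2 D dD" "belongs_to D H" and x: "x \<in> pts D" "x \<notin> pts dD"
  shows "nbrs H x \<subseteq> pts D"
proof -
  have "manifold_with_boundary 2 D dD"
    using D(1) by (cases rule: digital_disk.cases) auto
  then have "\<exists>(M :: 'a graph) v f. closed_manifold 2 M \<and> v \<in> pts M \<and> graph_iso f (delete_point M v) D \<and>
      dD = induced D (f ` nbrs M v)"
    by (cases rule: manifold_with_boundary.cases) blast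
  then obtain M :: "'a graph" and v f where M: "closed_manifold 2 M" "v \<in> pts M" "graph_iso f (delete_point M v) D"
    and dD: "dD = induced D (f ` nbrs M v)"
    by (elim exE conjE)
  have spM: "digital_space M" and linkM: "\<And>y. y \<in> pts M \<Longrightarrow> digital_sphere 1 (rim M y)"
    using M(1) by (auto elim: closed_manifold.cases)
  have Dsub: "pts D \<subseteq> pts H" and De: "D = induced H (pts D)"
    using D(2) unfolding belongs_to_def by blast+
  have Dedge: "(y, z) \<in> edges D \<Longrightarrow> (y, z) \<in> edges H" for y z
    using arg_cong[OF De, of edges] by auto
  have delp: "pts (delete_point M v) = pts M - {v}" by (auto simp: delete_point_def)
  have bij: "bij_betw f (pts M - {v}) (pts D)"
    and iso: "\<And>y z. y \<in> pts M - {v} \<Longrightarrow> z \<in> pts M - {v} \<Longrightarrow>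
      (y, z) \<in> edges M \<longleftrightarrow> (f y, f z) \<in> edges D"
    using M(3) unfolding graph_iso_def delp by (auto simp: delete_point_def)
  have inj: "inj_on f (pts M - {v})" using bij by (simp add: bij_betw_def)
  obtain x' where x': "x' \<in> pts M - {v}" "x = f x'"
    using bij x(1) unfolding bij_betw_def by blast
  \<comment> \<open>A point off the boundary is not adjacent to the deleted point \<open>v\<close>,
    so its link in \<open>M\<close> survives completely in \<open>D\<close>.\<close>
  have "x' \<notin> nbrs M v" using x x' unfolding dD by auto
  then have v_notin: "v \<notin> nbrs M x'" using edgesD(3)[OF spM] unfolding nbrs_def by blast
  have N: "nbrs M x' \<subseteq> pts M - {v}" using nbrs_subset[OF spM, of x'] v_notin by blast
  have rimM: "digital_sphere 1 (rim M x')" using linkM x' by blast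
  have prim: "pts (rim M x') = nbrs M x'" using N by (auto simp: rim_def)
  let ?X = "f ` nbrs M x'"
  have XD: "?X \<subseteq> pts D" using N bij unfolding bij_betw_def by blast
  have XN: "?X \<subseteq> nbrs H x"
  proof
    fix z assume "z \<in> ?X"
    then obtain y where y: "y \<in> nbrs M x'" "z = f y" by blast
    then have "(x', y) \<in> edges M" by (simp add: nbrs_def)
    then have "(x, z) \<in> edges D" using iso[OF x'(1)] N y x'(2) by blast
    then show "z \<in> nbrs H x" using Dedge nbrs_iff by blast
  qed
  have xH: "x \<in> pts H" using x(1) Dsub by blast
  have "?X = nbrs H x"
  proof (rule conn_onD[OF link_conn[OF xH] XN])
    have "pts (rim M x') \<noteq> {}" using sphere1D(3)[OF rimM] by (simp add: connected_graph_def)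
    then show "?X \<noteq> {}" using prim by simp
    fix z t assume zt: "z \<in> ?X" "t \<in> nbrs H x" "(z, t) \<in> edges H"
    then obtain y where y: "y \<in> nbrs M x'" "z = f y" by blast
    obtain a b where ab: "a \<noteq> b" "nbrs (rim M x') y = {a, b}"
      using sphere1_nbrs[OF rimM] y(1) prim by metis
    have "a \<in> nbrs (rim M x') y" "b \<in> nbrs (rim M x') y" using ab(2) by simp_all
    then have ab': "a \<in> nbrs M x'" "b \<in> nbrs M x'" "(y, a) \<in> edges M" "(y, b) \<in> edges M"
      by (simp_all add: nbrs_def rim_def)
    have "(z, f a) \<in> edges D" "(z, f b) \<in> edges D" using iso ab' y N by blast+
    then have "(z, f a) \<in> edges H" "(z, f b) \<in> edges H" using Dedge by blast+
    then have "f a \<in> nbrs H x \<inter> nbrs H z" "f b \<in> nbrs H x \<inter> nbrs H z"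
      using XN ab'(1,2) nbrs_iff by blast+
    moreover have "(x, z) \<in> edges H" using zt(1) XN nbrs_iff by blast
    then obtain p r where "nbrs H x \<inter> nbrs H z = {p, r}" using common_nbrs by metis
    moreover have "f a \<noteq> f b" using inj_onD[OF inj] ab(1) ab'(1,2) N by blast
    moreover have "t \<in> nbrs H x \<inter> nbrs H z" using zt nbrs_iff by blast
    ultimately have "t = f a \<or> t = f b" by auto
    then show "t \<in> ?X" using ab'(1,2) by blast
  qed
  with XD show ?thesis by blast
qed

text \<open>The disk in which a path is embedded supplies the region \<open>D\<close> of
  \<open>coboundary_if_engulfed\<close>: contractibility yields a primitive on it, and the inner
  points of the path are interior to it, so their neighbours belong to it as well.\<close>

lemma coh_trivial_if_embedded:
  assumes emb: "\<And>D dD. digital_disk 1 D dD \<Longrightarrow> belongs_to D H \<Longrightarrow> embedded_one_disk H D dD"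
  shows "coh_trivial H"
  unfolding coh_trivial_def
proof (intro conjI allI impI)
  show "conn_on (edges H) (pts H)" by (rule conn)
  fix \<phi> assume \<phi>: "cocycle H \<phi>"
  show "coboundary H \<phi>"
  proof (rule coboundary_if_engulfed[OF \<phi>])
    fix q l assume q: "induced_path H q l" and l: "2 \<le> l"
    let ?P = "q ` {..l}"
    have P: "?P \<subseteq> pts H" "inj_on q {..l}" using q unfolding induced_path_def by blast+
    have "belongs_to (induced H ?P) H"
      using P(1) unfolding belongs_to_def by (simp add: Int_absorb2)
    from emb[OF path_disk[OF q l] this]
    obtain D2 dD2 where D2: "digital_disk 2 D2 dD2" "belongs_to D2 H"
      and int: "belongs_to (interior_space (induced H ?P) (induced H {q 0, q l})) (interior_space D2 dD2)"
      unfolding embedded_one_disk_def by blast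
    have "contractible_graph D2" using D2(1) by (cases rule: digital_disk.cases) auto
    then have triv: "coh_trivial D2" by (rule contractible_coh_trivial)
    have De: "D2 = induced H (pts D2)" using D2(2) unfolding belongs_to_def by blast
    have edges_D2: "edges D2 = edges H \<inter> pts D2 \<times> pts D2"
      using arg_cong[OF De, of edges] by simp
    have "cocycle D2 \<phi>" by (rule cocycle_mono[OF \<phi>]) (simp add: edges_D2)
    from coh_trivialD[OF triv this]
    obtain f :: "'a \<Rightarrow> bool" where f: "\<forall>x y. (x, y) \<in> edges D2 \<longrightarrow> \<phi> x y = (f x \<noteq> f y)" by (rule exE)
    have "q i \<in> pts D2 \<and> nbrs H (q i) \<subseteq> pts D2" if i: "0 < i" "i < l" for i
    proof -
      have "q i \<noteq> q 0" "q i \<noteq> q l"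
        using i inj_onD[OF P(2), of i 0] inj_onD[OF P(2), of i l] by auto
      then have "q i \<in> pts (interior_space (induced H ?P) (induced H {q 0, q l}))"
        using i P(1) unfolding interior_space_def by auto
      then have "q i \<in> pts (interior_space D2 dD2)" using int unfolding belongs_to_def by blast
      then have "q i \<in> pts D2" "q i \<notin> pts dD2" unfolding interior_space_def by simp_all
      then show ?thesis using disk_interior_nbrs[OF D2] by blast
    qed
    moreover have "\<forall>x\<in>pts D2. \<forall>y\<in>pts D2. (x, y) \<in> edges H \<longrightarrow> \<phi> x y = (f x \<noteq> f y)"
      using f unfolding edges_D2 by simp
    ultimately show "\<exists>D. \<exists>f :: 'a \<Rightarrow> bool. (\<forall>x\<in>D. \<forall>y\<in>D. (x, y) \<in> edges H \<longrightarrow> \<phi> x y = (f x \<noteq> f y)) \<and>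
        (\<forall>i. 0 < i \<longrightarrow> i < l \<longrightarrow> q i \<in> D \<and> nbrs H (q i) \<subseteq> D)"
      by (intro exI[of _ "pts D2"] exI[of _ f]) simp
  qed
qed

end

theorem theorem5p2:
  fixes H :: "'a::infinite graph"
  assumes "closed_manifold 2 H"
    and "finite (pts H)"
    and "\<And>D dD. digital_disk 1 D dD \<Longrightarrow> belongs_to D H \<Longrightarrow> embedded_one_disk H D dD"
  shows "digital_sphere 2 H"
proof -
  have H: "digital_space H" "connected_graph H" "\<forall>v\<in>pts H. digital_sphere (2 - 1) (rim H v)"
    using assms(1) by (auto elim: closed_manifold.cases)
  interpret finite_surface H
    by unfold_locales (use H assms(2) connected_graph_iff[OF H(1)] in simp_all)
  show ?thesis by (rule coh_trivial_imp_sphere[OF coh_trivial_if_embedded[OF assms(3)]])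
qed

end
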